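(* The bijection $\Theta:\mathcal{F}_n\to\vec{C}_{n,1}$ and its inverse can be computed in linear time. That is, there is an algorithm which, given $n\ge 2$ and a function $f\in\mathcal{F}_n$ as the list of pairs $\langle i,f(i)\rangle$, $i=2,\ldots,n-1$, outputs in time $O(n)$ the list of pairs $\langle i,t_i\rangle$, $i=2,\ldots,n$, such that $(i,t_i)$ is the directed edge out of $i$ in $\Theta(f)$; and there is an algorithm which, given a tree $T\in\vec{C}_{n,1}$ as such a list of pairs, outputs in time $O(n)$ the list of pairs $\langle i,f(i)\rangle$, $i=2,\ldots,n-1$, for $f=\Theta^{-1}(T)$.
   Context: Let $\mathcal{F}_n$ be the set of functions $f:\{2,\ldots,n-1\}\to\{1,\ldots,n\}$ and let $\vec{C}_{n,1}$ be the set of trees on the vertex set $\{1,\ldots,n\}$ rooted at $1$, with all edges directed towards the root $1$. The digraph $\mathrm{graph}(f)$ has vertex set $\{1,\ldots,n\}$ and edges $(i,f(i))$ for $i=2,\ldots,n-1$. The bijection $\Theta:\mathcal{F}_n\to\vec{C}_{n,1}$ (of Eğecioğlu and Remmel) is defined as follows. Let $c_1,\ldots,c_a$ be the directed cycles of $\mathrm{graph}(f)$ (loops, i.e. cycles of length $1$, included), ordered so that their maximum elements $m_1,\ldots,m_a$ satisfy $m_1>m_2>\cdots>m_a$, and put $l_i=f(m_i)$ (so $l_i=m_i$ if $c_i$ is a loop). Then $\Theta(f)$ is obtained from $\mathrm{graph}(f)$ by deleting the edges $(m_i,l_i)$ for $i=1,\ldots,a$ and adding the directed edges $(n,l_1)$,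 $(m_i,l_{i+1})$ for $i=1,\ldots,a-1$, and $(m_a,1)$. If $\mathrm{graph}(f)$ has no cycles, $\Theta(f)$ is obtained by adding the single directed edge $(n,1)$. Time is counted in elementary operations (array access, pointer updates, comparisons and assignments on integers of size at most polynomial in $n$, each at unit cost). *)

theory Defs
  imports "HOL-Library.FuncSet" "Graph_Theory.Graph_Theory"
begin

section \<open>Functions, rooted trees and the map Theta\<close>

text \<open>
  Functions are extensional, so that they are determined by their values on \<open>{2..n-1}\<close>
  and equality of functions is equality of these values. For \<open>n = 2\<close> the domain is empty.
\<close>

definition fun_space :: "nat \<Rightarrow> (nat \<Rightarrow> nat) set" where
  "fun_space n = {2..n - 1} \<rightarrow>\<^sub>E {1..n}"

definition fun_graph :: "nat \<Rightarrow> (nat \<Rightarrow> nat) \<Rightarrow> nat pair_pre_digraph" where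
  "fun_graph n f = \<lparr>pverts = {1..n}, parcs = {(i, f i) | i. i \<in> {2..n - 1}}\<rparr>"

text \<open>
  The constants \<^const>\<open>forest\<close> and \<^const>\<open>tree\<close> of the library only exclude directed cycles
  (a directed diamond would be a \<^const>\<open>tree\<close>). Here the underlying undirected graph has to be
  a tree: it is connected and has no simple cycle. Each undirected edge occurs as two opposite
  arcs of \<^const>\<open>mk_symmetric\<close>, so undirected cycles are the cycles there of length at least 3;
  the condition on opposite arcs says that every edge has exactly one direction and that there
  are no loops.
\<close>

definition oriented_tree :: "nat pair_pre_digraph \<Rightarrow> bool" where
  "oriented_tree T \<longleftrightarrow>
     pair_wf_digraph T \<and>
     (\<forall>u v. (u, v) \<in> parcs T \<longrightarrow> (v, u) \<notin> parcs T) \<and>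
     connected (with_proj T) \<and>
     \<not> (\<exists>p. pre_digraph.cycle (with_proj (mk_symmetric (with_proj T))) p \<and> 3 \<le> length p)"

definition rooted_trees :: "nat \<Rightarrow> nat pair_pre_digraph set" where
  "rooted_trees n =
     {T. pverts T = {1..n} \<and> oriented_tree T \<and> (\<forall>v \<in> {1..n}. v \<rightarrow>\<^sup>*\<^bsub>with_proj T\<^esub> 1)}"

text \<open>
  A directed cycle of the graph of a function is determined by its set of vertices, and different
  cycles have disjoint vertex sets. Loops are cycles of length 1.
\<close>

definition cycle_vertex_sets :: "nat pair_pre_digraph \<Rightarrow> nat set set" where
  "cycle_vertex_sets G = {fst ` set p | p. pre_digraph.cycle (with_proj G) p}"

definition cycle_maxima :: "nat \<Rightarrow> (nat \<Rightarrow> nat) \<Rightarrow> nat list" where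
  "cycle_maxima n f = rev (sorted_list_of_set (Max ` cycle_vertex_sets (fun_graph n f)))"

definition Theta :: "nat \<Rightarrow> (nat \<Rightarrow> nat) \<Rightarrow> nat pair_pre_digraph" where
  "Theta n f =
     (let m = cycle_maxima n f; a = length m;
          deleted = {(m ! i, f (m ! i)) | i. i < a};
          added = (if a = 0 then {(n, 1)}
                   else {(n, f (m ! 0))}
                      \<union> {(m ! i, f (m ! (i + 1))) | i. i + 1 < a}
                      \<union> {(m ! (a - 1), 1)})
      in \<lparr>pverts = {1..n}, parcs = (parcs (fun_graph n f) - deleted) \<union> added\<rparr>)"


section \<open>A random access machine with unit costs\<close>

text \<open>
  Programs are finite pieces of syntax over integer registers and integer arrays, both named
  by natural numbers. The only arithmetic is stepping by one. Every instruction and every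
  evaluation of a test costs one unit of time. The parameter \<open>W\<close> of the semantics is the largest
  integer that the machine can produce; a program that would exceed it has no execution.
  Since an array index is read from a register, it also bounds the addresses in use.
\<close>

datatype test =
    Less nat nat
  | LessEq nat nat
  | Equal nat nat
  | NotEqual nat nat

datatype com =
    Skip
  | SetConst nat nat
  | Copy nat nat
  | Inc nat
  | Dec nat
  | Load nat nat nat
  | Store nat nat nat
  | Seq com com
  | If test com com
  | While test com

record state =
  reg :: "nat \<Rightarrow> nat"
  arr :: "nat \<Rightarrow> nat \<Rightarrow> nat"

fun holds :: "test \<Rightarrow> state \<Rightarrow> bool" where
  "holds (Less x y) s \<longleftrightarrow> reg s x < reg s y"
| "holds (LessEq x y) s \<longleftrightarrow> reg s x \<le> reg s y"
| "holds (Equal x y) s \<longleftrightarrow> reg s x = reg s y"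
| "holds (NotEqual x y) s \<longleftrightarrow> reg s x \<noteq> reg s y"

definition set_reg :: "nat \<Rightarrow> nat \<Rightarrow> state \<Rightarrow> state" where
  "set_reg x v s = s\<lparr>reg := (reg s)(x := v)\<rparr>"

definition set_arr :: "nat \<Rightarrow> nat \<Rightarrow> nat \<Rightarrow> state \<Rightarrow> state" where
  "set_arr a i v s = s\<lparr>arr := (arr s)(a := (arr s a)(i := v))\<rparr>"

text \<open>
  \<open>exec W c s t s'\<close>: started in \<open>s\<close>, the program \<open>c\<close> halts in \<open>s'\<close> after exactly \<open>t\<close> units of time.
  \<open>Load x a y\<close> is \<open>x := a[y]\<close>, and \<open>Store a x y\<close> is \<open>a[x] := y\<close>. \<open>Dec\<close> leaves 0 unchanged.
\<close>

inductive exec :: "nat \<Rightarrow> com \<Rightarrow> state \<Rightarrow> nat \<Rightarrow> state \<Rightarrow> bool" for W where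
  exec_Skip: "exec W Skip s 1 s"
| exec_SetConst: "k \<le> W \<Longrightarrow> exec W (SetConst x k) s 1 (set_reg x k s)"
| exec_Copy: "exec W (Copy x y) s 1 (set_reg x (reg s y) s)"
| exec_Inc: "reg s x + 1 \<le> W \<Longrightarrow> exec W (Inc x) s 1 (set_reg x (reg s x + 1) s)"
| exec_Dec: "exec W (Dec x) s 1 (set_reg x (reg s x - 1) s)"
| exec_Load: "exec W (Load x a y) s 1 (set_reg x (arr s a (reg s y)) s)"
| exec_Store: "exec W (Store a x y) s 1 (set_arr a (reg s x) (reg s y) s)"
| exec_Seq: "exec W c1 s1 t1 s2 \<Longrightarrow> exec W c2 s2 t2 s3 \<Longrightarrow> exec W (Seq c1 c2) s1 (t1 + t2) s3"
| exec_IfTrue: "holds b s \<Longrightarrow> exec W c1 s t s' \<Longrightarrow> exec W (If b c1 c2) s (1 + t) s'"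
| exec_IfFalse: "\<not> holds b s \<Longrightarrow> exec W c2 s t s' \<Longrightarrow> exec W (If b c1 c2) s (1 + t) s'"
| exec_WhileFalse: "\<not> holds b s \<Longrightarrow> exec W (While b c) s 1 s"
| exec_WhileTrue: "holds b s1 \<Longrightarrow> exec W c s1 t1 s2 \<Longrightarrow> exec W (While b c) s2 t2 s3 \<Longrightarrow>
    exec W (While b c) s1 (1 + t1 + t2) s3"

text \<open>
  A list of pairs is stored in an array with the two components of pair number \<open>k\<close> in the
  cells \<open>2 * k\<close> and \<open>2 * k + 1\<close>. Initially register 0 contains \<open>n\<close>, array 0 the input list, and
  everything else is 0. When the program halts, array 1 contains the output list and register 1
  the number of its pairs.
\<close>

definition pairs_array :: "(nat \<times> nat) list \<Rightarrow> nat \<Rightarrow> nat" where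
  "pairs_array ps j =
     (if j < 2 * length ps then (if even j then fst (ps ! (j div 2)) else snd (ps ! (j div 2)))
      else 0)"

definition initial_state :: "nat \<Rightarrow> (nat \<times> nat) list \<Rightarrow> state" where
  "initial_state n ps =
     \<lparr>reg = (\<lambda>x. if x = 0 then n else 0), arr = (\<lambda>a. if a = 0 then pairs_array ps else (\<lambda>_. 0))\<rparr>"

definition output_pairs :: "state \<Rightarrow> (nat \<times> nat) list" where
  "output_pairs s = map (\<lambda>k. (arr s 1 (2 * k), arr s 1 (2 * k + 1))) [0..<reg s 1]"

text \<open>
  \<open>X n\<close> is the set of instances of size \<open>n\<close>, and \<open>inp\<close> and \<open>out\<close> give the input and output lists.
  One program has to work for all \<open>n\<close>, in time at most \<open>C * n\<close> and with integers bounded by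
  the polynomial \<open>D * n ^ k\<close>.
\<close>

definition linear_time_computable ::
  "(nat \<Rightarrow> 'a set) \<Rightarrow> (nat \<Rightarrow> 'a \<Rightarrow> (nat \<times> nat) list) \<Rightarrow> (nat \<Rightarrow> 'a \<Rightarrow> (nat \<times> nat) list) \<Rightarrow> bool"
where
  "linear_time_computable X inp out \<longleftrightarrow>
     (\<exists>P C D k. \<forall>n \<ge> 2. \<forall>x \<in> X n. \<exists>t s.
        exec (D * n ^ k) P (initial_state n (inp n x)) t s \<and> t \<le> C * n \<and>
        output_pairs s = out n x)"

definition fun_pairs :: "nat \<Rightarrow> (nat \<Rightarrow> nat) \<Rightarrow> (nat \<times> nat) list" where
  "fun_pairs n f = map (\<lambda>i. (i, f i)) [2..<n]"

text \<open>
  In a tree with all edges directed towards the root 1, every other vertex has exactly one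
  outgoing edge, so the description below is proper.
\<close>

definition tree_pairs :: "nat \<Rightarrow> nat pair_pre_digraph \<Rightarrow> (nat \<times> nat) list" where
  "tree_pairs n T = map (\<lambda>i. (i, THE j. (i, j) \<in> parcs T)) [2..<n + 1]"

end

theory Submission
  imports Defs
begin

text \<open>
  A tree rooted at 1 is the same as a function \<open>g\<close> on \<open>{2..n}\<close> without cycles. If the cycles of \<open>f\<close> are
  written as words ending in their maxima and are concatenated by decreasing maxima, then the
  tree \<open>Theta n f\<close> has this word as its path from \<open>n\<close> to 1 and agrees with \<open>f\<close> elsewhere. Conversely the
  cycles are recovered by cutting the path from \<open>n\<close> to 1 after each right-to-left maximum.

  For the running time, all cycles are found by walks that stop at vertices seen before, so that
  every vertex is paid for once. Then a scan from \<open>n - 1\<close> down to 2 meets the maxima in decreasing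
  order without sorting. The inverse only needs the path from \<open>n\<close> to 1, traversed once in each direction.
\<close>

section \<open>Graphs of functions\<close>

text \<open>The proof soon leaves the definition of \<open>Theta\<close>. A relation
  \<open>theta_rel\<close> links \<open>f\<close>, the parent function \<open>g\<close> of the tree
  and the list \<open>bs\<close> of cycles, and both the bijection and the two programs are proved
  against it. Its existence for given \<open>f\<close> computes \<open>Theta n f\<close>, its
  existence for given \<open>g\<close> yields surjectivity, and injectivity holds because
  \<open>g\<close> determines the word and the word determines \<open>bs\<close>. The order by
  decreasing maxima is what makes the last step possible.

  The obstacle on the side of trees is that \<open>rooted_trees\<close> speaks of the underlying
  undirected graph. That each vertex other than 1 has a single outgoing arc is therefore a result;
  it comes from comparing a tree with a spanning subtree of arcs that approach the root.\<close>

definition fgraph :: "nat set \<Rightarrow> nat set \<Rightarrow> (nat \<Rightarrow> nat) \<Rightarrow> nat pair_pre_digraph" where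
  "fgraph V D f = \<lparr>pverts = V, parcs = {(i, f i) | i. i \<in> D}\<rparr>"

lemma fgraph_simps [simp]:
  "pverts (fgraph V D f) = V" "parcs (fgraph V D f) = {(i, f i) | i. i \<in> D}"
  by (simp_all add: fgraph_def)

lemma fun_graph_eq_fgraph: "fun_graph n f = fgraph {1..n} {2..n - 1} f"
  by (simp add: fun_graph_def fgraph_def)

text \<open>The list may start at any vertex of the cycle, so a cycle occurs in all its rotations
  and only \<open>set b\<close> identifies it. The domain is a parameter because \<open>f\<close>
  lives on \<open>{2..n - 1}\<close> and parent functions on \<open>{2..n}\<close>.\<close>

definition fun_cycle :: "nat set \<Rightarrow> (nat \<Rightarrow> nat) \<Rightarrow> nat list \<Rightarrow> bool" where
  "fun_cycle D f b \<longleftrightarrow> b \<noteq> [] \<and> set b \<subseteq> D \<and> distinct b \<and>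
     successively (\<lambda>x y. f x = y) b \<and> f (last b) = hd b"

lemma tl_pawalk_verts: "tl (pawalk_verts u p) = map snd p" if "pcas u p v"
proof -
  have "pawalk_verts u p = u # map snd p" if "pcas u p v" for u
    using that by (induction p arbitrary: u) auto
  then show ?thesis using that by simp
qed

lemma cycle_with_proj_iff:
  "pre_digraph.cycle (with_proj G) p \<longleftrightarrow>
     (\<exists>u. u \<in> pverts G \<and> set p \<subseteq> parcs G \<and> pcas u p u \<and> distinct (map snd p) \<and> p \<noteq> [])"
  unfolding pre_digraph.cycle_def pre_digraph.awalk_def cas_with_proj_eq awalk_verts_with_proj_eq
  by (auto simp: tl_pawalk_verts)

lemma pcas_append:
  "pcas u (p @ q) v \<longleftrightarrow> (\<exists>w. pcas u p w \<and> pcas w q v)"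
  by (induction p arbitrary: u) auto

lemma pcas_graph_iff:
  "pcas u (map (\<lambda>x. (x, f x)) b) v \<longleftrightarrow>
     (if b = [] then u = v
      else hd b = u \<and> successively (\<lambda>x y. f x = y) b \<and> f (last b) = v)"
proof (induction b arbitrary: u)
  case (Cons x b)
  then show ?case by (cases b) (auto simp: successively_Cons)
qed simp

lemma map_successively:
  "successively (\<lambda>x y. f x = y) b \<Longrightarrow> b \<noteq> [] \<Longrightarrow> map f b = tl b @ [f (last b)]"
  by (induction b) (auto simp: successively_Cons)

text \<open>An arc of a function graph is determined by its tail, so a closed walk is
  \<open>f\<close> listed along its tails. The library asks for distinct heads; on a cycle these are
  the tails rotated by one place.\<close>

lemma cycle_fgraph_iff:
  assumes "D \<subseteq> V"
  shows "pre_digraph.cycle (with_proj (fgraph V D f)) p \<longleftrightarrow>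
    (\<exists>b. fun_cycle D f b \<and> p = map (\<lambda>x. (x, f x)) b)"
proof -
  have arcs: "p = map (\<lambda>x. (x, f x)) (map fst p) \<and> set (map fst p) \<subseteq> D"
    if "set p \<subseteq> {(i, f i) | i. i \<in> D}" for p
    using that by (induction p) auto
  have dist: "distinct (map snd (map (\<lambda>x. (x, f x)) b)) \<longleftrightarrow> distinct b"
    if "successively (\<lambda>x y. f x = y) b" "f (last b) = hd b" "b \<noteq> []" for b
  proof -
    have "map snd (map (\<lambda>x. (x, f x)) b) = rotate1 b"
      using map_successively[OF that(1,3)] that(2,3) by (cases b) (auto simp: comp_def)
    then show ?thesis by simp
  qed
  show ?thesis
  proof
    assume "pre_digraph.cycle (with_proj (fgraph V D f)) p"
    then obtain u where u: "set p \<subseteq> {(i, f i) | i. i \<in> D}" "pcas u p u" "distinct (map snd p)" "p \<noteq> []"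
      by (auto simp: cycle_with_proj_iff)
    define b where "b = map fst p"
    have p: "p = map (\<lambda>x. (x, f x)) b" and b: "set b \<subseteq> D" "b \<noteq> []"
      using arcs[OF u(1)] u(4) by (auto simp: b_def)
    have "hd b = u" "successively (\<lambda>x y. f x = y) b" "f (last b) = u"
      using u(2) b(2) unfolding p pcas_graph_iff by auto
    then have "fun_cycle D f b"
      using dist[of b] u(3) b unfolding fun_cycle_def p by auto
    then show "\<exists>b. fun_cycle D f b \<and> p = map (\<lambda>x. (x, f x)) b" using p by blast
  next
    assume "\<exists>b. fun_cycle D f b \<and> p = map (\<lambda>x. (x, f x)) b"
    then obtain b where b: "fun_cycle D f b" and p: "p = map (\<lambda>x. (x, f x)) b" by blast
    have "pcas (hd b) p (hd b)"
      using b unfolding p pcas_graph_iff fun_cycle_def by auto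
    moreover have "hd b \<in> V"
      using b assms unfolding fun_cycle_def by (meson hd_in_set subsetD)
    moreover have "set p \<subseteq> parcs (fgraph V D f)" "p \<noteq> []"
      using b assms by (auto simp: fun_cycle_def p)
    moreover have "distinct (map snd p)"
      using dist[of b] b by (simp add: p fun_cycle_def)
    ultimately show "pre_digraph.cycle (with_proj (fgraph V D f)) p"
      unfolding cycle_with_proj_iff by auto
  qed
qed

lemma cycle_vertex_sets_fun_graph:
  "cycle_vertex_sets (fun_graph n f) = {set b | b. fun_cycle {2..n - 1} f b}"
proof -
  have "{2..n - 1} \<subseteq> {1..n}" by auto
  note * = cycle_fgraph_iff[OF this, of f]
  have "fst ` set (map (\<lambda>x. (x, f x)) b) = set b" for b
    by (force simp: image_iff)
  with * show ?thesis
    unfolding cycle_vertex_sets_def fun_graph_eq_fgraph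
    by (auto; metis)
qed

text \<open>The bridge from lists to relations: a nonempty closed walk contains a cycle. For
  finitely many arcs, \<open>acyclic\<close> then supplies the well-founded inductions over
  trees.\<close>

lemma acyclic_fgraph_iff:
  assumes "D \<subseteq> V" "f \<in> D \<rightarrow> V"
  shows "acyclic (parcs (fgraph V D f)) \<longleftrightarrow> (\<nexists>b. fun_cycle D f b)"
proof -
  interpret wf_digraph "with_proj (fgraph V D f)"
    by unfold_locales (use assms in \<open>simp_all, auto\<close>)
  have "acyclic (parcs (fgraph V D f)) \<longleftrightarrow> (\<nexists>p. cycle p)"
  proof
    assume ac: "acyclic (parcs (fgraph V D f))"
    show "\<nexists>p. cycle p"
    proof
      assume "\<exists>p. cycle p"
      then obtain u p where "awalk u p u" "p \<noteq> []" by (auto simp: cycle_def)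
      then have "(u, u) \<in> (parcs (fgraph V D f))\<^sup>+"
        using reachable1_awalk[of u u] by auto
      with ac show False by (simp add: acyclic_def)
    qed
  next
    assume nc: "\<nexists>p. cycle p"
    show "acyclic (parcs (fgraph V D f))"
      unfolding acyclic_def
    proof (intro allI notI)
      fix u assume "(u, u) \<in> (parcs (fgraph V D f))\<^sup>+"
      then obtain p where "awalk u p u" "p \<noteq> []"
        using reachable1_awalk[of u u] by auto
      then have "closed_w p" by (auto simp: closed_w_def)
      with nc closed_w_imp_cycle show False by blast
    qed
  qed
  then show ?thesis using cycle_fgraph_iff[OF assms(1), of f] by auto
qed

section \<open>Rooted trees as parent functions\<close>

text \<open>Not extensional, unlike \<open>fun_space\<close>: parent functions are built by changing
  \<open>f\<close> along a path, and only their values on \<open>{2..n}\<close> enter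
  \<open>tree_of\<close>.\<close>

definition rooted_fun :: "nat \<Rightarrow> (nat \<Rightarrow> nat) \<Rightarrow> bool" where
  "rooted_fun n g \<longleftrightarrow> g \<in> {2..n} \<rightarrow> {1..n} \<and> (\<nexists>b. fun_cycle {2..n} g b)"

definition tree_of :: "nat \<Rightarrow> (nat \<Rightarrow> nat) \<Rightarrow> nat pair_pre_digraph" where
  "tree_of n g = fgraph {1..n} {2..n} g"

lemma pcas_conv: "pcas u p v \<Longrightarrow> p \<noteq> [] \<Longrightarrow> fst (hd p) = u \<and> snd (last p) = v"
  by (induction p arbitrary: u) auto

lemma reachable_with_proj:
  "u \<rightarrow>\<^sup>*\<^bsub>with_proj G\<^esub> v \<longleftrightarrow> (u, v) \<in> (parcs G)\<^sup>* \<and> u \<in> pverts G" if "pair_wf_digraph G"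
proof -
  interpret pair_wf_digraph G by fact
  show ?thesis by (metis reachable_conv' reachable_in_verts(1))
qed

text \<open>Both directions are needed. The converse relation lets an induction pass from a vertex
  to its parent; the relation itself yields, in a nonempty set of vertices, one without children in
  the set.\<close>

lemma rooted_fun_wf:
  assumes "rooted_fun n g"
  shows "wf {(i, g i) | i. i \<in> {2..n}}" and "wf ({(i, g i) | i. i \<in> {2..n}}\<inverse>)"
proof -
  have "{(i, g i) | i. i \<in> {2..n}} = (\<lambda>i. (i, g i)) ` {2..n}" by auto
  then have fin: "finite {(i, g i) | i. i \<in> {2..n}}" by simp
  have "{2..n} \<subseteq> {1..n}" by auto
  from acyclic_fgraph_iff[OF this, of g] assms
  have "acyclic {(i, g i) | i. i \<in> {2..n}}"
    by (auto simp: rooted_fun_def)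
  with fin show "wf {(i, g i) | i. i \<in> {2..n}}" "wf ({(i, g i) | i. i \<in> {2..n}}\<inverse>)"
    by (auto intro: finite_acyclic_wf finite_acyclic_wf_converse)
qed

lemma rooted_fun_induct [consumes 2, case_names one step]:
  assumes "rooted_fun n g" and "x \<in> {1..n}"
  assumes "P 1" and "\<And>x. x \<in> {2..n} \<Longrightarrow> g x \<in> {1..n} \<Longrightarrow> P (g x) \<Longrightarrow> P x"
  shows "P x"
  using assms(2)
proof (induction x rule: wf_induct_rule[OF rooted_fun_wf(2)[OF assms(1)]])
  case (1 x)
  show ?case
  proof (cases "x = 1")
    case False
    then have x: "x \<in> {2..n}" using 1 by auto
    moreover have "g x \<in> {1..n}" using x assms(1) by (auto simp: rooted_fun_def)
    ultimately show ?thesis using 1 assms(4) by auto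
  qed (use assms in simp)
qed

lemma tree_of_wf: "rooted_fun n g \<Longrightarrow> pair_wf_digraph (tree_of n g)"
  by unfold_locales (auto simp: tree_of_def rooted_fun_def Pi_iff)

lemma tree_of_reach:
  assumes "rooted_fun n g" "x \<in> {1..n}"
  shows "(x, 1) \<in> (parcs (tree_of n g))\<^sup>*"
  using assms
proof (induction rule: rooted_fun_induct)
  case (step x)
  then have "(x, g x) \<in> parcs (tree_of n g)" by (auto simp: tree_of_def)
  with step show ?case by (meson converse_rtrancl_into_rtrancl)
qed simp

section \<open>The underlying undirected graph of a tree\<close>

lemma parcs_mk_symmetric_with_proj:
  "parcs (mk_symmetric (with_proj G)) = parcs G \<union> (parcs G)\<inverse>"
  by (auto simp: parcs_mk_symmetric)

text \<open>The connection runs through \<open>r\<close>: up from \<open>u\<close> along arcs, then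
  down to \<open>v\<close> along reversed arcs.\<close>

lemma mk_symmetric_reach:
  assumes "pair_wf_digraph G" "\<And>x. x \<in> pverts G \<Longrightarrow> (x, r) \<in> (parcs G)\<^sup>*"
    and "u \<in> pverts G" "v \<in> pverts G"
  shows "u \<rightarrow>\<^sup>*\<^bsub>with_proj (mk_symmetric (with_proj G))\<^esub> v"
proof -
  interpret pair_wf_digraph G by fact
  have "(u, r) \<in> (parcs (mk_symmetric (with_proj G)))\<^sup>*"
    "(r, v) \<in> (parcs (mk_symmetric (with_proj G)))\<^sup>*"
    using assms(2)[OF assms(3)] assms(2)[OF assms(4)]
    unfolding parcs_mk_symmetric_with_proj
    by (meson in_rtrancl_UnI rtrancl_converseI)+
  then have "(u, v) \<in> (parcs (mk_symmetric (with_proj G)))\<^sup>*" by simp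
  moreover have "pair_wf_digraph (mk_symmetric (with_proj G))"
    using wellformed_mk_symmetric by simp
  ultimately show ?thesis using assms(3) by (simp add: reachable_with_proj)
qed

text \<open>Some vertex of the cycle has no child on it, so both its neighbours would be its parent.\<close>

lemma tree_of_no_undirected_cycle:
  assumes "rooted_fun n g"
  shows "\<not> (\<exists>p. pre_digraph.cycle (with_proj (mk_symmetric (with_proj (tree_of n g)))) p \<and>
    3 \<le> length p)"
proof
  let ?R = "{(i, g i) | i. i \<in> {2..n}}"
  assume "\<exists>p. pre_digraph.cycle (with_proj (mk_symmetric (with_proj (tree_of n g)))) p \<and> 3 \<le> length p"
  then obtain p u where p: "set p \<subseteq> ?R \<union> ?R\<inverse>" "pcas u p u" "distinct (map snd p)" "3 \<le> length p"
    by (auto simp: cycle_with_proj_iff parcs_mk_symmetric_with_proj tree_of_def simp del: mem_Collect_eq)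
  then have "fst (hd p) \<in> fst ` set p" by (cases p) auto
  then obtain v where v: "v \<in> fst ` set p" "\<And>y. (y, v) \<in> ?R \<Longrightarrow> y \<notin> fst ` set p"
    by (rule wfE_min[OF rooted_fun_wf(1)[OF assms]]) (rule that)
  then obtain e where "e \<in> set p" and e: "fst e = v" by blast
  then obtain q r where "p = q @ e # r" by (meson split_list)
  note qr = this e
  \<comment> \<open>Rotating the cycle to start in \<open>v\<close> puts its two arcs at
    \<open>v\<close> first and last. Length 3 leaves a nonempty middle part, so the two neighbours
    of \<open>v\<close> are heads of different arcs and hence distinct.\<close>
  define p' where "p' = (e # r) @ q"
  have "pcas v p' v"
    using p(2) qr unfolding p'_def by (auto simp: pcas_append)
  have set: "set p' = set p" by (auto simp: p'_def qr)
  have dist: "distinct (map snd p')" and len: "3 \<le> length p'"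
    using p(3,4) by (auto simp: p'_def qr)
  obtain e1 p2 e2 where p': "p' = e1 # p2 @ [e2]" "p2 \<noteq> []"
  proof -
    obtain e1 p1 where "p' = e1 # p1" using len by (cases p') auto
    moreover obtain p2 e2 where "p1 = p2 @ [e2]"
      using len calculation by (cases p1 rule: rev_cases) auto
    moreover have "p2 \<noteq> []" using len calculation by auto
    ultimately show thesis using that by blast
  qed
  have ends: "fst e1 = v" "snd e2 = v"
    using pcas_conv[OF \<open>pcas v p' v\<close>] unfolding p'(1) by simp_all
  obtain w where w: "pcas (snd e1) p2 w" "fst e2 = w"
    using \<open>pcas v p' v\<close> unfolding p'(1) by (auto simp: pcas_append)
  have "snd e1 \<noteq> w"
    using pcas_conv[OF w(1) p'(2)] dist last_in_set[OF p'(2)] unfolding p'(1) by force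
  have "snd e1 \<in> fst ` set p" "fst e2 \<in> fst ` set p"
    using pcas_conv[OF w(1) p'(2)] hd_in_set[OF p'(2)] unfolding set[symmetric] p'(1) by force+
  moreover have "e1 \<in> ?R \<union> ?R\<inverse>" "e2 \<in> ?R \<union> ?R\<inverse>" using p(1) set p'(1) by auto
  moreover obtain x y where "e1 = (v, x)" "e2 = (y, v)" using ends by (cases e1; cases e2) auto
  ultimately have "snd e1 = g v" "fst e2 = g v" using v(2) by auto
  then show False using \<open>snd e1 \<noteq> w\<close> w by simp
qed

lemma tree_of_in_rooted_trees:
  assumes "rooted_fun n g" "1 \<le> n"
  shows "tree_of n g \<in> rooted_trees n"
proof -
  have wf: "pair_wf_digraph (tree_of n g)" using assms tree_of_wf by simp
  have verts: "pverts (tree_of n g) = {1..n}" by (simp add: tree_of_def)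
  have "(v, u) \<notin> parcs (tree_of n g)" if "(u, v) \<in> parcs (tree_of n g)" for u v
    using wf_asym[OF rooted_fun_wf(1)[OF assms(1)]] that
    unfolding tree_of_def fgraph_simps by blast
  moreover have "connected (with_proj (tree_of n g))"
    unfolding connected_def strongly_connected_def
    using mk_symmetric_reach[OF wf tree_of_reach[OF assms(1)]] assms verts by simp
  moreover have "\<forall>v\<in>{1..n}. v \<rightarrow>\<^sup>*\<^bsub>with_proj (tree_of n g)\<^esub> 1"
    using tree_of_reach[OF assms(1)] wf verts by (simp add: reachable_with_proj)
  ultimately show ?thesis
    using tree_of_no_undirected_cycle[OF assms(1)] verts wf
    by (auto simp: rooted_trees_def oriented_tree_def)
qed

text \<open>An undirected path from \<open>w\<close> to \<open>u\<close> within \<open>H\<close> is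
  closed by the extra arc. The path has at least two arcs: a single one would be
  \<open>(u, w)\<close> itself, which is not in \<open>H\<close>, or its reverse, which
  \<open>asym\<close> excludes.\<close>

lemma undirected_cycle_of_extra_arc:
  assumes wf: "pair_wf_digraph T" and H: "pair_wf_digraph H" "pverts H = pverts T" "parcs H \<subseteq> parcs T"
    and reach: "\<And>x. x \<in> pverts H \<Longrightarrow> (x, r) \<in> (parcs H)\<^sup>*"
    and asym: "\<And>u v. (u, v) \<in> parcs T \<Longrightarrow> (v, u) \<notin> parcs T"
    and uw: "(u, w) \<in> parcs T" "(u, w) \<notin> parcs H"
  shows "\<exists>p. pre_digraph.cycle (with_proj (mk_symmetric (with_proj T))) p \<and> 3 \<le> length p"
proof -
  let ?S = "mk_symmetric (with_proj H)"
  interpret T: pair_wf_digraph T by fact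
  interpret H: pair_wf_digraph H by fact
  interpret S: pair_wf_digraph ?S using H.wellformed_mk_symmetric by simp
  have verts: "u \<in> pverts T" "w \<in> pverts T" using uw T.in_arcsD1 T.in_arcsD2 by auto
  have "w \<rightarrow>\<^sup>*\<^bsub>with_proj ?S\<^esub> u"
    using mk_symmetric_reach[OF H(1) reach] verts H(2) by simp
  then obtain p where p: "S.apath w p u" using S.reachable_apath by blast
  then have "distinct (pawalk_verts w p)" and cas: "pcas w p u" and sub: "set p \<subseteq> parcs ?S"
    by (auto simp: S.apath_def S.awalk_def)
  then have dist: "distinct (w # map snd p)"
    using tl_pawalk_verts[OF cas] by (cases p) auto
  have "u \<noteq> w" using asym uw by blast
  have len: "2 \<le> length p"
  proof (rule ccontr)
    assume "\<not> 2 \<le> length p"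
    then consider "p = []" | e where "p = [e]" by (cases p; cases "tl p") auto
    then show False
    proof cases
      case 2
      then have "p = [(w, u)]" using cas by (cases e) auto
      then have "(w, u) \<in> parcs H \<or> (u, w) \<in> parcs H"
        using sub by (auto simp: parcs_mk_symmetric_with_proj)
      then show False using uw asym H(3) by auto
    qed (use cas \<open>u \<noteq> w\<close> in auto)
  qed
  have "set ((u, w) # p) \<subseteq> parcs (mk_symmetric (with_proj T))"
    using sub H(3) uw(1) by (auto simp: parcs_mk_symmetric_with_proj)
  then have "pre_digraph.cycle (with_proj (mk_symmetric (with_proj T))) ((u, w) # p)"
    unfolding cycle_with_proj_iff using dist cas verts by auto
  with len show ?thesis by force
qed

text \<open>Every vertex other than 1 has an arc that decreases the distance \<open>d\<close> to 1.
  Choosing one such arc for each gives an acyclic \<open>g\<close> whose tree lies inside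
  \<open>T\<close> and spans it; any further arc of \<open>T\<close> would close an undirected
  cycle.\<close>

lemma rooted_trees_imp_tree_of:
  assumes "T \<in> rooted_trees n"
  shows "\<exists>g. rooted_fun n g \<and> T = tree_of n g"
proof -
  have verts: "pverts T = {1..n}" and T: "pair_wf_digraph T"
    and asym: "\<And>u v. (u, v) \<in> parcs T \<Longrightarrow> (v, u) \<notin> parcs T"
    and nocyc: "\<not> (\<exists>p. pre_digraph.cycle (with_proj (mk_symmetric (with_proj T))) p \<and> 3 \<le> length p)"
    and reach: "\<And>v. v \<in> {1..n} \<Longrightarrow> v \<rightarrow>\<^sup>*\<^bsub>with_proj T\<^esub> 1"
    using assms by (auto simp: rooted_trees_def oriented_tree_def)
  interpret T: pair_wf_digraph T by fact
  define d where "d v = (LEAST k. (v, 1) \<in> parcs T ^^ k)" for v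
  have "\<exists>w. (v, w) \<in> parcs T \<and> d w < d v" if v: "v \<in> {2..n}" for v
  proof -
    have "(v, 1) \<in> (parcs T)\<^sup>*" using reach[of v] v T by (simp add: reachable_with_proj)
    then have "\<exists>k. (v, 1) \<in> parcs T ^^ k" by (simp add: rtrancl_power)
    then have dv: "(v, 1) \<in> parcs T ^^ d v" unfolding d_def by (rule LeastI_ex)
    with v obtain k where k: "d v = Suc k" by (cases "d v") auto
    with dv obtain w where w: "(v, w) \<in> parcs T" "(w, 1) \<in> parcs T ^^ k"
      by (metis relpow_Suc_D2)
    then have "d w \<le> k" unfolding d_def by (intro Least_le)
    with w k show ?thesis by auto
  qed
  then obtain g where g: "\<And>v. v \<in> {2..n} \<Longrightarrow> (v, g v) \<in> parcs T \<and> d (g v) < d v" by metis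
  have range: "g \<in> {2..n} \<rightarrow> {1..n}" using g T.in_arcsD2 verts by blast
  have "{(i, g i) | i. i \<in> {2..n}}\<inverse> \<subseteq> measure d" using g by auto
  then have "acyclic {(i, g i) | i. i \<in> {2..n}}"
    by (meson acyclic_converse wf_acyclic wf_measure wf_subset)
  moreover have "{2..n} \<subseteq> {1..n}" by auto
  ultimately have rg: "rooted_fun n g"
    using acyclic_fgraph_iff[of "{2..n}" "{1..n}" g] range by (auto simp: rooted_fun_def)
  have "parcs T \<subseteq> parcs (tree_of n g)"
  proof (rule subrelI, rule ccontr)
    fix u w assume "(u, w) \<in> parcs T" "(u, w) \<notin> parcs (tree_of n g)"
    moreover have "parcs (tree_of n g) \<subseteq> parcs T" using g by (auto simp: tree_of_def)
    moreover have "pverts (tree_of n g) = pverts T" using verts by (simp add: tree_of_def)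
    ultimately show False
      using undirected_cycle_of_extra_arc[OF T tree_of_wf[OF rg], of 1 u w] nocyc asym
        tree_of_reach[OF rg] verts by auto
  qed
  moreover have "parcs (tree_of n g) \<subseteq> parcs T" using g by (auto simp: tree_of_def)
  ultimately have "parcs T = parcs (tree_of n g)" by blast
  then have "T = tree_of n g" using verts by (cases T) (simp add: tree_of_def fgraph_def)
  with rg show ?thesis by blast
qed

section \<open>Cycles of a function and blocks of a word\<close>

abbreviation path_of :: "(nat \<Rightarrow> nat) \<Rightarrow> nat list \<Rightarrow> bool" where
  "path_of f \<equiv> successively (\<lambda>x y. f x = y)"

lemma path_of_cong:
  assumes "path_of f b" "\<And>x. x \<in> set (butlast b) \<Longrightarrow> f x = g x"
  shows "path_of g b"
  using assms by (induction b) (auto simp: successively_Cons split: if_splits)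

lemma path_of_unique_fun:
  assumes "path_of f b" "path_of g b" "x \<in> set (butlast b)"
  shows "f x = g x"
  using assms by (induction b) (auto simp: successively_Cons split: if_splits)

lemma path_of_image:
  "path_of f b \<Longrightarrow> x \<in> set (butlast b) \<Longrightarrow> f x \<in> set (tl b)"
  by (induction b) (auto simp: successively_Cons split: if_splits intro: list.set_sel(2) hd_in_set)

lemma path_of_closed:
  assumes "path_of f (x # q)" "x \<in> C" "\<And>y. y \<in> C \<Longrightarrow> f y \<in> C"
  shows "set (x # q) \<subseteq> C"
  using assms(1,2)
proof (induction q arbitrary: x)
  case (Cons y q)
  then show ?case using assms(3)[of x] by auto
qed simp

lemma path_of_exists:
  assumes "distinct xs"
  shows "\<exists>g. path_of g xs \<and> (\<forall>x. x \<notin> set (butlast xs) \<longrightarrow> g x = f x)"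
  using assms
proof (induction xs)
  case (Cons x xs)
  then obtain g where g: "path_of g xs" "\<forall>x. x \<notin> set (butlast xs) \<longrightarrow> g x = f x" by auto
  show ?case
  proof (cases xs)
    case (Cons y ys)
    have "path_of (g(x := y)) xs"
      using g(1) by (rule path_of_cong) (use \<open>distinct (x # xs)\<close> in \<open>auto dest: in_set_butlastD\<close>)
    then show ?thesis using g(2) Cons by (intro exI[of _ "g(x := y)"]) auto
  qed auto
qed auto

text \<open>Walks from the same start agree step by step, and each stops at its only visit to
  \<open>z\<close>. This recovers the word from the parent function.\<close>

lemma path_of_end_unique:
  assumes "path_of f (u @ [z])" "path_of g (v @ [z])" "hd (u @ [z]) = hd (v @ [z])"
    and "z \<notin> set u" "z \<notin> set v" "\<And>x. x \<in> set u \<Longrightarrow> f x = g x"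
  shows "u = v"
  using assms
proof (induction u arbitrary: v)
  case Nil
  then show ?case by (cases v) auto
next
  case (Cons x u)
  then obtain v' where v: "v = x # v'" by (cases v) auto
  have "u = v'"
  proof (rule Cons.IH)
    show "hd (u @ [z]) = hd (v' @ [z])"
      using Cons.prems by (auto simp: v successively_Cons)
  qed (use Cons.prems in \<open>auto simp: v successively_Cons\<close>)
  then show ?case by (simp add: v)
qed

section \<open>Rotations and disjointness of cycles\<close>

lemma fun_cycle_append_swap:
  assumes "fun_cycle D f (p @ q)"
  shows "fun_cycle D f (q @ p)"
  using assms unfolding fun_cycle_def
  by (cases "p = []"; cases "q = []") (auto simp: successively_append_iff)

lemma fun_cycle_rotate_last:
  assumes "fun_cycle D f b" "x \<in> set b"
  shows "\<exists>c. fun_cycle D f c \<and> set c = set b \<and> last c = x"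
proof -
  obtain p q where b: "b = (p @ [x]) @ q" using assms(2) by (auto dest: split_list)
  then show ?thesis using fun_cycle_append_swap[of D f "p @ [x]" q] assms(1)
    by (intro exI[of _ "q @ p @ [x]"]) auto
qed

lemma fun_cycle_image:
  assumes "fun_cycle D f b" "x \<in> set b"
  shows "f x \<in> set b"
proof -
  have "map f b = tl b @ [hd b]"
    using assms(1) by (auto simp: fun_cycle_def map_successively)
  then have "f x \<in> set (tl b @ [hd b])" using assms(2) by (metis image_eqI set_map)
  then show ?thesis using assms(2) by (cases b) auto
qed

text \<open>Rotated to start in \<open>x\<close>, the cycle is a walk that never leaves
  \<open>S\<close>. Closedness of \<open>S\<close> is demanded on the cycle only.\<close>

lemma fun_cycle_subset:
  assumes "fun_cycle D f b" "x \<in> set b" "x \<in> S" "\<And>y. y \<in> S \<Longrightarrow> y \<in> set b \<Longrightarrow> f y \<in> S"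
  shows "set b \<subseteq> S"
proof -
  obtain p q where b: "b = p @ x # q" using assms(2) by (auto dest: split_list)
  have c: "fun_cycle D f (x # q @ p)"
    using fun_cycle_append_swap[of D f p "x # q"] assms(1) b by simp
  have "path_of f (x # q @ p)" using c by (simp add: fun_cycle_def)
  then have "set (x # q @ p) \<subseteq> S \<inter> set b"
    by (rule path_of_closed) (use assms fun_cycle_image in auto)
  then show ?thesis using b by auto
qed

lemma fun_cycle_eq_if_meet:
  assumes "fun_cycle D f b" "fun_cycle D' f c" "x \<in> set b" "x \<in> set c"
  shows "set b = set c"
  using fun_cycle_subset[OF assms(1,3,4)] fun_cycle_subset[OF assms(2,4,3)]
    fun_cycle_image assms by blast

lemma fun_cycle_cong:
  assumes "fun_cycle D f b" "set b \<subseteq> D'" "\<And>x. x \<in> set b \<Longrightarrow> f x = g x"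
  shows "fun_cycle D' g b"
  using assms path_of_cong[of f b g] in_set_butlastD[of _ b] last_in_set[of b]
  by (auto simp: fun_cycle_def)

text \<open>The last letters of the blocks are the right-to-left maxima of the word.\<close>

definition block_list :: "nat list list \<Rightarrow> bool" where
  "block_list bs \<longleftrightarrow> (\<forall>b \<in> set bs. b \<noteq> [] \<and> (\<forall>x \<in> set b. x \<le> last b)) \<and>
     sorted_wrt (>) (map last bs)"

text \<open>The last letter of the first block is the maximum of the whole suffix read so far, so
  one comparison decides whether \<open>x\<close> is a new right-to-left maximum.\<close>

fun add_block :: "nat \<Rightarrow> nat list list \<Rightarrow> nat list list" where
  "add_block x [] = [[x]]"
| "add_block x (b # bs) = (if last b < x then [x] # b # bs else (x # b) # bs)"

definition blocks :: "nat list \<Rightarrow> nat list list" where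
  "blocks w = foldr add_block w []"

lemma blocks_simps [simp]: "blocks [] = []" "blocks (x # w) = add_block x (blocks w)"
  by (simp_all add: blocks_def)

lemma concat_blocks [simp]: "concat (blocks w) = w"
proof (induction w)
  case (Cons x w)
  then show ?case by (cases "blocks w") auto
qed simp

lemma block_list_blocks: "block_list (blocks w)"
proof (induction w)
  case (Cons x w)
  then show ?case by (cases "blocks w") (auto simp: block_list_def)
qed (simp add: block_list_def)

text \<open>With \<open>concat_blocks\<close> and \<open>block_list_blocks\<close> this says that a
  word has exactly one factorisation into such blocks, which is the core of injectivity.\<close>

lemma blocks_concat: "block_list bs \<Longrightarrow> blocks (concat bs) = bs"
proof (induction bs)
  case (Cons b bs)
  then have IH: "blocks (concat bs) = bs" by (auto simp: block_list_def)
  have bs: "bs = [] \<or> last (hd bs) < last b"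
    using Cons.prems by (cases bs) (auto simp: block_list_def)
  \<comment> \<open>Generalised from \<open>b\<close> to its nonempty suffixes \<open>c\<close>,
    which share its last letter and have it as their maximum.\<close>
  have "foldr add_block c bs = c # bs"
    if "c \<noteq> []" "\<forall>x \<in> set c. x \<le> last c" "last c = last b" for c
    using that
  proof (induction c)
    case (Cons x c)
    show ?case
    proof (cases "c = []")
      case True
      then show ?thesis using Cons.prems bs by (cases bs) auto
    next
      case False
      then show ?thesis using Cons by auto
    qed
  qed simp
  then show ?case
    using Cons.prems IH by (auto simp: block_list_def blocks_def)
qed simp

lemma block_list_inj_last: "block_list bs \<Longrightarrow> inj_on last (set bs)"
proof -
  assume "block_list bs"
  then have "sorted_wrt (<) (rev (map last bs))"
    by (simp add: block_list_def sorted_wrt_rev del: rev_map)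
  then have "distinct (map last bs)" by (simp add: strict_sorted_iff del: rev_map)
  then show ?thesis by (simp add: distinct_map)
qed

lemma rev_sorted_list_of_set:
  assumes "sorted_wrt (>) xs"
  shows "rev (sorted_list_of_set (set xs)) = (xs :: nat list)"
proof -
  have "sorted_wrt (<) (rev xs)" using assms by (simp add: sorted_wrt_rev)
  then have "sorted_list_of_set (set (rev xs)) = rev xs"
    by (simp only: strict_sorted_iff sorted_list_of_set.idem_if_sorted_distinct)
  then show ?thesis by simp
qed

section \<open>Bijectivity\<close>

text \<open>
  The list \<open>bs\<close> consists of the cycles of \<open>f\<close>, each written with its maximum \<open>m\<^sub>i\<close> at the end
  (hence with \<open>l\<^sub>i\<close> at the front), and \<open>g\<close> is the parent function of the tree.
\<close>

definition theta_rel :: "nat \<Rightarrow> (nat \<Rightarrow> nat) \<Rightarrow> (nat \<Rightarrow> nat) \<Rightarrow> nat list list \<Rightarrow> bool" where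
  "theta_rel n f g bs \<longleftrightarrow>
     block_list bs \<and> distinct (concat bs) \<and> set (concat bs) \<subseteq> {2..n - 1} \<and>
     (\<forall>b \<in> set bs. fun_cycle {2..n - 1} f b) \<and>
     (\<forall>c. fun_cycle {2..n - 1} f c \<longrightarrow> (\<exists>b \<in> set bs. set c = set b)) \<and>
     path_of g (n # concat bs @ [1]) \<and>
     (\<forall>x \<in> {2..n - 1}. x \<notin> last ` set bs \<longrightarrow> g x = f x)"

text \<open>Cycles that meet coincide, so they can be indexed by their maxima; for each maximum a
  rotation ending in it is chosen.\<close>

lemma cycle_decomposition:
  "\<exists>bs. block_list bs \<and> distinct (concat bs) \<and> (\<forall>b \<in> set bs. fun_cycle {2..n - 1} f b) \<and>
     (\<forall>c. fun_cycle {2..n - 1} f c \<longrightarrow> (\<exists>b \<in> set bs. set c = set b))"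
proof -
  define M where "M = {Max (set c) | c. fun_cycle {2..n - 1} f c}"
  have Max_in: "Max (set c) \<in> set c" if "fun_cycle {2..n - 1} f c" for c
    using that by (auto simp: fun_cycle_def intro: Max_in)
  have "M \<subseteq> {2..n - 1}" using Max_in unfolding M_def fun_cycle_def by blast
  then have fin: "finite M" using finite_subset by blast
  have "\<exists>b. fun_cycle {2..n - 1} f b \<and> last b = m \<and> Max (set b) = m" if "m \<in> M" for m
    using that fun_cycle_rotate_last Max_in unfolding M_def by (smt (verit) mem_Collect_eq)
  then obtain B where
    B: "\<And>m. m \<in> M \<Longrightarrow> fun_cycle {2..n - 1} f (B m) \<and> last (B m) = m \<and> Max (set (B m)) = m"
    by metis
  define ms where "ms = rev (sorted_list_of_set M)"
  define bs where "bs = map B ms"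
  have set_ms: "set ms = M" using fin by (simp add: ms_def)
  have "map last bs = ms" using B set_ms by (auto simp: bs_def intro: map_idI)
  moreover have "sorted_wrt (>) ms" by (simp add: ms_def sorted_wrt_rev)
  moreover have "b \<noteq> [] \<and> (\<forall>x \<in> set b. x \<le> last b)" if b: "b \<in> set bs" for b
  proof -
    obtain m where m: "m \<in> M" "b = B m" using b set_ms by (auto simp: bs_def)
    then have "Max (set b) = last b" "b \<noteq> []" using B[OF m(1)] by (auto simp: fun_cycle_def)
    then show ?thesis by (metis List.finite_set Max_ge)
  qed
  ultimately have "block_list bs" by (simp add: block_list_def)
  moreover have "distinct (concat bs)"
  proof -
    have meet: "m = m'" if "m \<in> M" "m' \<in> M" "x \<in> set (B m)" "x \<in> set (B m')" for m m' x
      using that B fun_cycle_eq_if_meet by metis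
    have "distinct (concat (map B ks))" if "distinct ks" "set ks \<subseteq> M" for ks
      using that
    proof (induction ks)
      case (Cons k ks)
      then have "set (B k) \<inter> set (B m) = {}" if "m \<in> set ks" for m
        using that meet[of k m] by auto
      then show ?case using Cons B[of k] by (auto simp: fun_cycle_def)
    qed simp
    moreover have "distinct ms" by (simp add: ms_def)
    ultimately show ?thesis using set_ms by (simp add: bs_def)
  qed
  moreover have "\<forall>b \<in> set bs. fun_cycle {2..n - 1} f b" using B set_ms by (auto simp: bs_def)
  moreover have "\<exists>b \<in> set bs. set c = set b" if c: "fun_cycle {2..n - 1} f c" for c
  proof -
    have m: "Max (set c) \<in> M" using c by (auto simp: M_def)
    then have "Max (set c) \<in> set (B (Max (set c)))"
      using B[OF m] last_in_set[of "B (Max (set c))"] by (auto simp: fun_cycle_def)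
    then have "set c = set (B (Max (set c)))"
      using fun_cycle_eq_if_meet[OF c] B[OF m] Max_in[OF c] by blast
    then show ?thesis using m set_ms by (auto simp: bs_def)
  qed
  ultimately show ?thesis by blast
qed

lemma not_last_in_butlast:
  "x \<in> set b \<Longrightarrow> x \<noteq> last b \<Longrightarrow> x \<in> set (butlast b)"
  by (cases b rule: rev_cases) auto

text \<open>The letters of \<open>n # concat bs @ [1]\<close> are distinct, so a function can be
  prescribed along this word. Inside a block it agrees with \<open>f\<close>, because the block is a
  path of both; changes happen only at \<open>n\<close> and at the ends of blocks.\<close>

lemma theta_rel_exists:
  assumes "2 \<le> n"
  shows "\<exists>g bs. theta_rel n f g bs"
proof -
  obtain bs where bs: "block_list bs" "distinct (concat bs)"
      "\<And>b. b \<in> set bs \<Longrightarrow> fun_cycle {2..n - 1} f b"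
      "\<And>c. fun_cycle {2..n - 1} f c \<Longrightarrow> \<exists>b \<in> set bs. set c = set b"
    using cycle_decomposition by meson
  have sub: "set (concat bs) \<subseteq> {2..n - 1}" using bs(3) by (force simp: fun_cycle_def)
  then have "n \<notin> set (concat bs)" "1 \<notin> set (concat bs)" using assms by auto
  then have "distinct (n # concat bs @ [1])" using bs(2) assms by auto
  then obtain g where g: "path_of g (n # concat bs @ [1])"
      "\<And>x. x \<notin> set (butlast (n # concat bs @ [1])) \<Longrightarrow> g x = f x"
    using path_of_exists by meson
  have "g x = f x" if x: "x \<in> {2..n - 1}" "x \<notin> last ` set bs" for x
  proof (cases "x \<in> set (concat bs)")
    case True
    then obtain b where b: "b \<in> set bs" "x \<in> set b" by auto
    then have "x \<in> set (butlast b)" using x(2) by (auto intro: not_last_in_butlast)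
    moreover have "path_of g b"
      using g(1) b(1) by (auto dest!: split_list simp: successively_append_iff successively_Cons)
    moreover have "path_of f b" using bs(3)[OF b(1)] by (simp add: fun_cycle_def)
    ultimately show ?thesis by (rule path_of_unique_fun[rotated 2])
  next
    case False
    then show ?thesis using x(1) assms by (intro g(2)) (auto simp: butlast_append)
  qed
  then show ?thesis using bs sub g(1) unfolding theta_rel_def by blast
qed

text \<open>The shifted list \<open>p # map last bs\<close> treats all new arcs alike: its entry
  number \<open>i\<close> is the letter just before block \<open>i\<close>. For \<open>p = n\<close>
  and \<open>z = 1\<close> these are the arcs out of \<open>n\<close> and out of the maxima.\<close>

lemma path_of_concat:
  assumes "path_of g (p # concat bs @ [z])" "\<And>b. b \<in> set bs \<Longrightarrow> b \<noteq> []"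
  shows "i < length bs \<Longrightarrow> g ((p # map last bs) ! i) = hd (bs ! i)"
    and "g (last (p # map last bs)) = z"
proof -
  have "(\<forall>i < length bs. g ((p # map last bs) ! i) = hd (bs ! i)) \<and> g (last (p # map last bs)) = z"
    using assms
  proof (induction bs arbitrary: p)
    case (Cons b bs)
    then have "b \<noteq> []" by simp
    then have "path_of g (p # b)" "path_of g (last b # concat bs @ [z])"
      using Cons.prems(1) by (auto simp: successively_Cons successively_append_iff)
    then have IH: "\<forall>i < length bs. g ((last b # map last bs) ! i) = hd (bs ! i)"
        "g (last (last b # map last bs)) = z"
      using Cons.IH[of "last b"] Cons.prems(2) by auto
    have "g ((p # map last (b # bs)) ! i) = hd ((b # bs) ! i)" if "i < length (b # bs)" for i
      using that IH(1) \<open>path_of g (p # b)\<close> \<open>b \<noteq> []\<close>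
      by (cases i) (auto simp: successively_Cons)
    then show ?case using IH(2) by simp
  qed simp
  then show "i < length bs \<Longrightarrow> g ((p # map last bs) ! i) = hd (bs ! i)"
    and "g (last (p # map last bs)) = z" by blast+
qed

lemma theta_rel_maxima:
  assumes "theta_rel n f g bs"
  shows "Max ` {set b | b. fun_cycle {2..n - 1} f b} = set (map last bs)"
proof -
  have "Max (set b) = last b" if "b \<in> set bs" for b
    using that assms by (intro Max_eqI) (auto simp: theta_rel_def block_list_def)
  moreover have "{set b | b. fun_cycle {2..n - 1} f b} = set ` set bs"
    using assms by (auto simp: theta_rel_def)
  ultimately show ?thesis by (auto simp: image_image)
qed

lemma theta_rel_cycle_maxima:
  assumes "theta_rel n f g bs"
  shows "cycle_maxima n f = map last bs"
  using assms theta_rel_maxima[OF assms]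
  by (simp add: cycle_maxima_def cycle_vertex_sets_fun_graph rev_sorted_list_of_set theta_rel_def
      block_list_def del: set_map)

text \<open>The form of the relation without blocks. It fits both the arcs added in
  \<open>Theta\<close> and the in-place update \<open>shift_values\<close>.\<close>

lemma theta_rel_successors:
  assumes "theta_rel n f g bs" and m: "m = map last bs"
  shows "i < length m \<Longrightarrow> g ((n # m) ! i) = f (m ! i)"
    and "g (last (n # m)) = 1"
    and "x \<in> {2..n - 1} \<Longrightarrow> x \<notin> set m \<Longrightarrow> g x = f x"
proof -
  have path: "path_of g (n # concat bs @ [1])" and ne: "\<And>b. b \<in> set bs \<Longrightarrow> b \<noteq> []"
    and cyc: "\<And>b. b \<in> set bs \<Longrightarrow> f (last b) = hd b"
    using assms by (auto simp: theta_rel_def fun_cycle_def block_list_def)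
  show "g ((n # m) ! i) = f (m ! i)" if "i < length m"
    using path_of_concat(1)[OF path ne, of i] that cyc m by simp
  show "g (last (n # m)) = 1"
    using path_of_concat(2)[OF path ne] m by simp
  show "x \<in> {2..n - 1} \<Longrightarrow> x \<notin> set m \<Longrightarrow> g x = f x"
    using assms by (auto simp: theta_rel_def)
qed

lemma Theta_eq_tree_of:
  assumes "theta_rel n f g bs" "2 \<le> n"
  shows "Theta n f = tree_of n g"
proof -
  define m where "m = map last bs"
  note succ = theta_rel_successors[OF assms(1) m_def]
  have m: "cycle_maxima n f = m" using theta_rel_cycle_maxima[OF assms(1)] m_def by simp
  have "b \<noteq> [] \<and> set b \<subseteq> {2..n - 1}" if "b \<in> set bs" for b
    using that assms(1) by (auto simp: theta_rel_def fun_cycle_def)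
  then have mset: "set m \<subseteq> {2..n - 1}" by (force simp: m_def)
  have deleted: "{(m ! i, f (m ! i)) | i. i < length m} = {(x, f x) | x. x \<in> set m}"
    by (auto simp: in_set_conv_nth)
  \<comment> \<open>The added arcs are those of \<open>g\<close> with tail \<open>n\<close> or a
    maximum, while the deleted ones are those of \<open>f\<close> at the maxima. Hence every tail in
    \<open>{2..n}\<close> keeps exactly one arc.\<close>
  have added: "(if length m = 0 then {(n, 1)} else {(n, f (m ! 0))}
        \<union> {(m ! i, f (m ! (i + 1))) | i. i + 1 < length m} \<union> {(m ! (length m - 1), 1)})
      = {(x, g x) | x. x \<in> insert n (set m)}"
  proof (cases "length m = 0")
    case True
    then show ?thesis using succ(2) by auto
  next
    case False
    have "{(n, f (m ! 0))} = {(n, g n)}" using succ(1)[of 0] False by simp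
    moreover have "{(m ! i, f (m ! (i + 1))) | i. i + 1 < length m}
        = {(m ! i, g (m ! i)) | i. i + 1 < length m}"
      using succ(1)[of "Suc _"] by auto
    moreover have "{(m ! (length m - 1), 1)} = {(m ! (length m - 1), g (m ! (length m - 1)))}"
      using succ(2) False by (simp add: last_conv_nth split: if_splits)
    moreover have "{(m ! i, g (m ! i)) | i. i + 1 < length m}
        \<union> {(m ! (length m - 1), g (m ! (length m - 1)))} = {(x, g x) | x. x \<in> set m}"
    proof -
      have "{..<length m} = {i. i + 1 < length m} \<union> {length m - 1}" using False by auto
      moreover have "set m = (!) m ` {..<length m}" by (auto simp: in_set_conv_nth)
      ultimately show ?thesis by auto
    qed
    ultimately show ?thesis using False by auto
  qed
  have "{(i, f i) | i. i \<in> {2..n - 1}} - {(x, f x) | x. x \<in> set m}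
      \<union> {(x, g x) | x. x \<in> insert n (set m)} = {(i, g i) | i. i \<in> {2..n}}"
  proof -
    have "{2..n} = insert n {2..n - 1}" using assms(2) by auto
    then show ?thesis using succ(3) mset by auto
  qed
  then show ?thesis
    unfolding Theta_def Let_def m deleted added fun_graph_eq_fgraph fgraph_simps
      tree_of_def fgraph_def by simp
qed

text \<open>A cycle contains the image of each of its vertices, so after meeting the path it must
  follow it to the end. It is also used with \<open>z = 1\<close>, which lies on no cycle.\<close>

lemma path_of_reaches_end:
  assumes "path_of g (w @ [z])" "fun_cycle D g c" "x \<in> set c" "x \<in> set (w @ [z])"
  shows "z \<in> set c"
proof -
  obtain p q where w: "w @ [z] = p @ x # q" using assms(4) by (meson split_list)
  then have "path_of g (x # q)" using assms(1) by (simp add: successively_append_iff)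
  then have "set (x # q) \<subseteq> set c"
    by (rule path_of_closed) (use assms fun_cycle_image in auto)
  moreover have "z \<in> set (x # q)"
    using w by (metis last_appendR last_in_set last_snoc list.distinct(1))
  ultimately show ?thesis by blast
qed

text \<open>A cycle of \<open>g\<close> cannot meet the word, since it would then contain 1. Off the
  word \<open>g\<close> equals \<open>f\<close>, so it would be a cycle of \<open>f\<close>; but all
  vertices of those are letters of the word.\<close>

lemma theta_rel_rooted:
  assumes rel: "theta_rel n f g bs" and f: "f \<in> fun_space n" and n: "2 \<le> n"
  shows "rooted_fun n g"
proof -
  define w where "w = n # concat bs"
  have path: "path_of g (w @ [1])" using rel by (simp add: theta_rel_def w_def)
  have sub: "set (concat bs) \<subseteq> {2..n - 1}" using rel by (simp add: theta_rel_def)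
  then have w: "set w \<subseteq> {2..n}" using n by (force simp: w_def)
  have lasts: "x \<in> set (concat bs)" if x: "x \<in> last ` set bs" for x
  proof -
    obtain b where "b \<in> set bs" "x = last b" using x by auto
    moreover have "b \<noteq> []" using calculation rel by (auto simp: theta_rel_def block_list_def)
    ultimately show ?thesis by (metis UN_I last_in_set set_concat)
  qed
  have eq: "g x = f x" if "x \<in> {2..n - 1}" "x \<notin> set w" for x
  proof -
    have "x \<notin> last ` set bs" using lasts that(2) by (auto simp: w_def)
    then show ?thesis using rel that(1) by (simp add: theta_rel_def)
  qed
  have "g x \<in> {1..n}" if x: "x \<in> {2..n}" for x
  proof (cases "x \<in> set w")
    case True
    then have "g x \<in> set (tl (w @ [1]))" using path_of_image[OF path, of x] by simp
    then show ?thesis using w n by (auto simp: w_def)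
  next
    case False
    then have "x \<in> {2..n - 1}" using x by (auto simp: w_def)
    then show ?thesis using eq False f by (auto simp: fun_space_def)
  qed
  moreover have "\<not> fun_cycle {2..n} g c" for c
  proof
    assume c: "fun_cycle {2..n} g c"
    have "set c \<subseteq> {2..n}" using c by (simp add: fun_cycle_def)
    moreover have "1 \<notin> {2..n}" by simp
    ultimately have "1 \<notin> set c" by blast
    then have "set c \<inter> set w = {}"
      using path_of_reaches_end[OF path c] by auto
    moreover have "n \<in> set w" by (simp add: w_def)
    ultimately have "set c \<subseteq> {2..n} - {n}" using \<open>set c \<subseteq> {2..n}\<close> by blast
    then have "set c \<subseteq> {2..n - 1}" by fastforce
    then have "fun_cycle {2..n - 1} f c"
      using eq \<open>set c \<inter> set w = {}\<close> by (intro fun_cycle_cong[OF c]) blast+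
    then obtain b where "b \<in> set bs" "set c = set b" using rel by (auto simp: theta_rel_def)
    then have "set c \<subseteq> set w" by (auto simp: w_def)
    then have "c = []" using \<open>set c \<inter> set w = {}\<close> by (simp add: Int_absorb2)
    then show False using c by (simp add: fun_cycle_def)
  qed
  ultimately show ?thesis by (auto simp: rooted_fun_def)
qed

section \<open>Recovering the function from the tree\<close>

lemma rooted_fun_path:
  assumes "rooted_fun n g" "x \<in> {1..n}"
  shows "\<exists>w. path_of g (w @ [1]) \<and> hd (w @ [1]) = x \<and> set w \<subseteq> {2..n} \<and> distinct w"
  using assms
proof (induction rule: rooted_fun_induct)
  case one
  show ?case by (rule exI[of _ "[]"]) simp
next
  case (step x)
  then obtain w where w: "path_of g (w @ [1])" "hd (w @ [1]) = g x" "set w \<subseteq> {2..n}" "distinct w"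
    by blast
  have path: "path_of g ((x # w) @ [1])"
    using w(1,2) by (simp add: successively_Cons)
  have "x \<notin> set w"
  proof
    assume "x \<in> set w"
    then obtain p q where pq: "w = p @ x # q" "x \<notin> set p" by (metis split_list_first)
    have "path_of g ((x # p) @ x # q @ [1])" using path pq(1) by simp
    then have "fun_cycle {2..n} g (x # p)"
      using pq w(3,4) step unfolding successively_append_iff by (auto simp: fun_cycle_def)
    then show False using assms(1) by (auto simp: rooted_fun_def)
  qed
  then show ?case using w(3,4) path step by (intro exI[of _ "x # w"]) auto
qed

text \<open>Each block of the path from \<open>n\<close> is closed to a cycle, and \<open>g\<close>
  is kept elsewhere. A cycle of \<open>f\<close> other than these would avoid all ends of blocks and
  thus be a cycle of \<open>g\<close>.\<close>

lemma theta_rel_surj: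
  assumes g: "rooted_fun n g" and n: "2 \<le> n"
  shows "\<exists>f \<in> fun_space n. \<exists>bs. theta_rel n f g bs"
proof -
  obtain v where v: "path_of g (v @ [1])" "hd (v @ [1]) = n" "set v \<subseteq> {2..n}" "distinct v"
    using rooted_fun_path[OF g, of n] n by auto
  then obtain w where vw: "v = n # w" using n by (cases v) auto
  define bs where "bs = blocks w"
  have concat: "concat bs = w" and bl: "block_list bs"
    by (simp_all add: bs_def block_list_blocks)
  have w: "set w \<subseteq> {2..n - 1}" "distinct w"
    using v(3,4) vw n by (auto simp: subset_iff) (metis One_nat_def Suc_pred le_eq_less_or_eq less_Suc_eq_le less_le_trans pos2)
  have ne: "b \<noteq> [] \<and> set b \<subseteq> set w" if "b \<in> set bs" for b
    using that bl concat[symmetric] by (auto simp: block_list_def)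
  \<comment> \<open>By \<open>block_list_inj_last\<close> the last letter determines its block, so
    \<open>inv_into\<close> finds the block that is to be closed.\<close>
  define h where "h x = (if x \<in> last ` set bs then hd (inv_into (set bs) last x) else g x)" for x
  define f where "f = restrict h {2..n - 1}"
  have h_last: "h (last b) = hd b" if "b \<in> set bs" for b
    using that block_list_inj_last[OF bl] by (simp add: h_def inv_into_f_f)
  have f_last: "f (last b) = hd b" if "b \<in> set bs" for b
  proof -
    have "last b \<in> {2..n - 1}" using ne[OF that] w(1) last_in_set[of b] by blast
    then show ?thesis using h_last[OF that] by (simp add: f_def)
  qed
  have f_other: "f x = g x" if "x \<in> {2..n - 1}" "x \<notin> last ` set bs" for x
    using that by (simp add: f_def h_def)
  have "f x \<in> {1..n}" if x: "x \<in> {2..n - 1}" for x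
  proof (cases "x \<in> last ` set bs")
    case True
    then obtain b where "b \<in> set bs" "x = last b" by auto
    then have "f x = hd b" "hd b \<in> {2..n - 1}"
      using f_last ne[of b] hd_in_set[of b] w(1) by blast+
    then show ?thesis by auto
  next
    case False
    then show ?thesis using f_other[OF x] g x by (auto simp: rooted_fun_def)
  qed
  then have fs: "f \<in> fun_space n" by (auto simp: fun_space_def f_def)
  have cyc: "fun_cycle {2..n - 1} f b" if b: "b \<in> set bs" for b
  proof -
    obtain xs ys where bs: "bs = xs @ b # ys" using b by (meson split_list)
    have dist: "distinct (concat xs @ b @ concat ys)" using w(2) concat bs by simp
    have "path_of g (n # concat xs @ b @ concat ys @ [1])"
      using v(1) unfolding vw concat[symmetric] bs by simp
    then have "path_of g b" by (auto simp: successively_append_iff successively_Cons)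
    moreover have "g x = f x" if x: "x \<in> set (butlast b)" for x
    proof -
      have "x \<noteq> last c" if c: "c \<in> set bs" for c
      proof (cases "c = b")
        case True
        then show ?thesis using dist x by (cases b rule: rev_cases) auto
      next
        case False
        then have "set c \<inter> set b = {}" using c dist bs by auto
        then show ?thesis using x ne[OF c] last_in_set[of c] in_set_butlastD by fastforce
      qed
      then show ?thesis using f_other[of x] x ne[OF b] w(1) in_set_butlastD[of x b] by force
    qed
    ultimately have "path_of f b" by (rule path_of_cong)
    then show ?thesis using dist ne[OF b] w(1) f_last[OF b] by (auto simp: fun_cycle_def)
  qed
  have cover: "\<exists>b \<in> set bs. set c = set b" if c: "fun_cycle {2..n - 1} f c" for c
  proof (rule ccontr)
    assume neg: "\<not> (\<exists>b \<in> set bs. set c = set b)"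
    have "x \<notin> last ` set bs" if "x \<in> set c" for x
    proof
      assume "x \<in> last ` set bs"
      then obtain b where b: "b \<in> set bs" "x = last b" by auto
      then have "x \<in> set b" using ne[of b] by auto
      then show False using fun_cycle_eq_if_meet[OF c cyc[OF b(1)] \<open>x \<in> set c\<close>] neg b(1) by blast
    qed
    then have "fun_cycle {2..n} g c"
      using c f_other by (intro fun_cycle_cong[OF c]) (fastforce simp: fun_cycle_def)+
    then show False using g by (auto simp: rooted_fun_def)
  qed
  have "theta_rel n f g bs"
    unfolding theta_rel_def using bl w concat cyc cover f_other v(1) vw by auto
  then show ?thesis using fs by blast
qed

text \<open>The walk of \<open>g\<close> from \<open>n\<close> to 1 fixes the word,
  \<open>blocks_concat\<close> fixes the blocks, and \<open>f\<close> maps the end of each block to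
  its start and equals \<open>g\<close> elsewhere.\<close>

lemma theta_rel_inj:
  assumes rel: "theta_rel n f g bs" "theta_rel n f' g' bs'"
    and eq: "\<And>x. x \<in> {2..n} \<Longrightarrow> g x = g' x"
    and fs: "f \<in> fun_space n" "f' \<in> fun_space n" and n: "2 \<le> n"
  shows "f = f'"
proof -
  have "n # concat bs = n # concat bs'"
  proof (rule path_of_end_unique[of g _ 1 g'])
    show "path_of g ((n # concat bs) @ [1])" "path_of g' ((n # concat bs') @ [1])"
      using rel by (auto simp: theta_rel_def)
    have sub: "set (n # concat bs) \<subseteq> {2..n}" "set (n # concat bs') \<subseteq> {2..n}"
      using rel n unfolding theta_rel_def by force+
    moreover have "1 \<notin> {2..n}" by simp
    ultimately show "1 \<notin> set (n # concat bs)" "1 \<notin> set (n # concat bs')" by blast+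
    show "g x = g' x" if "x \<in> set (n # concat bs)" for x using that sub(1) eq by blast
  qed simp
  then have bs: "bs = bs'" using rel blocks_concat by (metis list.inject theta_rel_def)
  have "f x = f' x" if x: "x \<in> {2..n - 1}" for x
  proof (cases "x \<in> last ` set bs")
    case True
    then show ?thesis using rel bs by (auto simp: theta_rel_def fun_cycle_def)
  next
    case False
    then have "f x = g x" "f' x = g' x" using rel bs x by (auto simp: theta_rel_def)
    then show ?thesis using eq x by auto
  qed
  then show ?thesis using fs unfolding fun_space_def by (intro PiE_ext[of f])
qed

lemma tree_of_eqD: "tree_of n g = tree_of n g' \<Longrightarrow> x \<in> {2..n} \<Longrightarrow> g x = g' x"
proof -
  assume "tree_of n g = tree_of n g'" "x \<in> {2..n}"
  then have "(x, g x) \<in> parcs (tree_of n g')" by (auto simp: tree_of_def fgraph_def)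
  then show ?thesis by (simp add: tree_of_def)
qed

theorem Theta_bij_betw:
  assumes "2 \<le> n"
  shows "bij_betw (Theta n) (fun_space n) (rooted_trees n)"
  unfolding bij_betw_def
proof (intro conjI inj_onI equalityI subsetI)
  fix f f' assume f: "f \<in> fun_space n" "f' \<in> fun_space n" "Theta n f = Theta n f'"
  obtain g bs g' bs' where rel: "theta_rel n f g bs" "theta_rel n f' g' bs'"
    using theta_rel_exists[OF assms] by meson
  then have "tree_of n g = tree_of n g'" using f(3) Theta_eq_tree_of assms by metis
  then show "f = f'" using theta_rel_inj[OF rel] tree_of_eqD f assms by blast
next
  fix T assume "T \<in> Theta n ` fun_space n"
  then obtain f where f: "f \<in> fun_space n" "T = Theta n f" by auto
  obtain g bs where rel: "theta_rel n f g bs" using theta_rel_exists[OF assms] by meson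
  then show "T \<in> rooted_trees n"
    using Theta_eq_tree_of[OF rel assms] theta_rel_rooted[OF rel f(1) assms]
      tree_of_in_rooted_trees f(2) assms by auto
next
  fix T assume "T \<in> rooted_trees n"
  then obtain g where g: "rooted_fun n g" "T = tree_of n g"
    using rooted_trees_imp_tree_of by blast
  then obtain f bs where "f \<in> fun_space n" "theta_rel n f g bs"
    using theta_rel_surj assms by blast
  then show "T \<in> Theta n ` fun_space n" using Theta_eq_tree_of assms g(2) by (metis imageI)
qed

lemma tree_pairs_tree_of: "tree_pairs n (tree_of n g) = map (\<lambda>i. (i, g i)) [2..<n + 1]"
  by (auto simp: tree_pairs_def tree_of_def)

section \<open>Weakest preconditions for the machine\<close>

text \<open>The time is an argument of the postcondition. Existence of an execution covers
  termination and the bound \<open>W\<close> on integers, just as in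
  \<open>linear_time_computable\<close>.\<close>

definition wp :: "nat \<Rightarrow> com \<Rightarrow> (state \<Rightarrow> nat \<Rightarrow> bool) \<Rightarrow> state \<Rightarrow> bool" where
  "wp W c Q s \<longleftrightarrow> (\<exists>t s'. exec W c s t s' \<and> Q s' t)"

inductive_cases exec_elims:
  "exec W Skip s t s'" "exec W (SetConst x k) s t s'" "exec W (Copy x y) s t s'"
  "exec W (Inc x) s t s'" "exec W (Dec x) s t s'" "exec W (Load x a y) s t s'"
  "exec W (Store a x y) s t s'" "exec W (Seq c1 c2) s t s'" "exec W (If b c1 c2) s t s'"

lemma wp_simps [simp]:
  "wp W Skip Q s \<longleftrightarrow> Q s 1"
  "wp W (SetConst x k) Q s \<longleftrightarrow> k \<le> W \<and> Q (set_reg x k s) 1"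
  "wp W (Copy x y) Q s \<longleftrightarrow> Q (set_reg x (reg s y) s) 1"
  "wp W (Inc x) Q s \<longleftrightarrow> reg s x + 1 \<le> W \<and> Q (set_reg x (reg s x + 1) s) 1"
  "wp W (Dec x) Q s \<longleftrightarrow> Q (set_reg x (reg s x - 1) s) 1"
  "wp W (Load x a y) Q s \<longleftrightarrow> Q (set_reg x (arr s a (reg s y)) s) 1"
  "wp W (Store a x y) Q s \<longleftrightarrow> Q (set_arr a (reg s x) (reg s y) s) 1"
  "wp W (Seq c1 c2) Q s \<longleftrightarrow> wp W c1 (\<lambda>s' t. wp W c2 (\<lambda>s'' t'. Q s'' (t + t')) s') s"
  "wp W (If b c1 c2) Q s \<longleftrightarrow>
     (if holds b s then wp W c1 (\<lambda>s' t. Q s' (1 + t)) s else wp W c2 (\<lambda>s' t. Q s' (1 + t)) s)"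
  unfolding wp_def
  by ((fastforce intro: exec.intros elim: exec_elims)+)[8]
    (cases "holds b s"; fastforce intro: exec.intros elim: exec_elims)

lemma wp_mono:
  "wp W c Q s \<Longrightarrow> (\<And>s' t. Q s' t \<Longrightarrow> Q' s' t) \<Longrightarrow> wp W c Q' s"
  unfolding wp_def by blast

text \<open>The number \<open>N\<close> is the time that remains for the loop, so it also serves as a variant.\<close>

lemma wp_While:
  assumes "I s N"
    and "\<And>s N. I s N \<Longrightarrow> holds b s \<Longrightarrow> wp W c (\<lambda>s' t. \<exists>N'. I s' N' \<and> t + 1 + N' \<le> N) s"
  shows "wp W (While b c) (\<lambda>s' t. \<exists>N'. I s' N' \<and> \<not> holds b s' \<and> t + N' \<le> N + 1) s"
  using assms(1)
proof (induction N arbitrary: s rule: less_induct)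
  case (less N)
  show ?case
  proof (cases "holds b s")
    case True
    from assms(2)[OF less.prems this] obtain t s' N' where
      step: "exec W c s t s'" "I s' N'" "t + 1 + N' \<le> N" unfolding wp_def by blast
    then have "wp W (While b c) (\<lambda>s'' t. \<exists>N''. I s'' N'' \<and> \<not> holds b s'' \<and> t + N'' \<le> N' + 1) s'"
      by (intro less.IH) auto
    then obtain t' s'' N'' where
      rest: "exec W (While b c) s' t' s''" "I s'' N''" "\<not> holds b s''" "t' + N'' \<le> N' + 1"
      unfolding wp_def by blast
    have "exec W (While b c) s (1 + t + t') s''"
      using True step(1) rest(1) by (rule exec_WhileTrue)
    moreover have "1 + t + t' + N'' \<le> N + 1" using step(3) rest(4) by simp
    ultimately show ?thesis using rest(2,3) unfolding wp_def by blast
  next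
    case False
    then have "exec W (While b c) s 1 s" by (rule exec_WhileFalse)
    then show ?thesis using False less.prems unfolding wp_def by fastforce
  qed
qed

lemma wp_WhileI:
  assumes "I s N"
    and "\<And>s N. I s N \<Longrightarrow> holds b s \<Longrightarrow> wp W c (\<lambda>s' t. \<exists>N'. I s' N' \<and> t + 1 + N' \<le> N) s"
    and "\<And>s' t N'. I s' N' \<Longrightarrow> \<not> holds b s' \<Longrightarrow> t + N' \<le> N + 1 \<Longrightarrow> Q s' t"
  shows "wp W (While b c) Q s"
  using wp_While[of I s N b W c] assms by (blast intro: wp_mono)

lemma set_simps [simp]:
  "reg (set_reg x v s) = (reg s)(x := v)" "arr (set_reg x v s) = arr s"
  "reg (set_arr a i v s) = reg s" "arr (set_arr a i v s) = (arr s)(a := (arr s a)(i := v))"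
  by (simp_all add: set_reg_def set_arr_def)

definition frame :: "nat set \<Rightarrow> nat set \<Rightarrow> state \<Rightarrow> state \<Rightarrow> bool" where
  "frame R A s s' \<longleftrightarrow> (\<forall>r. r \<notin> R \<longrightarrow> reg s' r = reg s r) \<and> (\<forall>a. a \<notin> A \<longrightarrow> arr s' a = arr s a)"

lemma frame_refl [simp]: "frame R A s s"
  by (simp add: frame_def)

lemma frame_set [simp]:
  "x \<in> R \<Longrightarrow> frame R A s s' \<Longrightarrow> frame R A s (set_reg x v s')"
  "a \<in> A \<Longrightarrow> frame R A s s' \<Longrightarrow> frame R A s (set_arr a i v s')"
  by (auto simp: frame_def)

lemma frameD:
  "frame R A s s' \<Longrightarrow> r \<notin> R \<Longrightarrow> reg s' r = reg s r"
  "frame R A s s' \<Longrightarrow> a \<notin> A \<Longrightarrow> arr s' a = arr s a"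
  by (auto simp: frame_def)

text \<open>
  In all programs register 0 holds \<open>n\<close>, register 5 the upper end of the range to be read or written,
  register 7 the constant 0 and register 8 the constant 1. Array 2 is the current function, array 3
  the colours or the predecessors of the vertices, and array 4 marks the maxima of the cycles.
\<close>

definition read_pairs :: com where
  "read_pairs = Seq (SetConst 2 2) (Seq (SetConst 3 0) (While (Less 2 5)
     (Seq (Inc 3) (Seq (Load 4 0 3) (Seq (Inc 3) (Seq (Store 2 2 4) (Inc 2)))))))"

definition write_pairs :: com where
  "write_pairs = Seq (SetConst 1 0) (Seq (SetConst 2 2) (Seq (SetConst 3 0) (While (Less 2 5)
     (Seq (Store 1 3 2) (Seq (Inc 3) (Seq (Load 4 2 2) (Seq (Store 1 3 4)
       (Seq (Inc 3) (Seq (Inc 2) (Inc 1))))))))))"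

text \<open>The upper end \<open>h\<close> is exclusive: it is \<open>n\<close> for a function and
  \<open>n + 1\<close> for a tree. The list is sorted by first components, so the value at
  \<open>i\<close> stands in cell \<open>2 * (i - 2) + 1\<close>. An iteration costs 6, five
  instructions and the test.\<close>

lemma wp_read_pairs:
  assumes "arr s 0 = pairs_array (map (\<lambda>i. (i, f i)) [2..<h])" "arr s 2 = (\<lambda>_. 0)"
    and "reg s 5 = h" "2 \<le> h" "2 * h \<le> W"
  shows "wp W read_pairs (\<lambda>s' t. arr s' 2 = (\<lambda>x. if 2 \<le> x \<and> x < h then f x else 0) \<and>
    frame {2, 3, 4} {2} s s' \<and> t \<le> 6 * h + 3) s"
proof -
  define I where "I s' N \<longleftrightarrow> 2 \<le> reg s' 2 \<and> reg s' 2 \<le> h \<and> reg s' 3 = 2 * (reg s' 2 - 2) \<and>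
      arr s' 2 = (\<lambda>x. if 2 \<le> x \<and> x < reg s' 2 then f x else 0) \<and>
      frame {2, 3, 4} {2} s s' \<and> N = 6 * (h - reg s' 2)" for s' N
  let ?b = "Seq (Inc 3) (Seq (Load 4 0 3) (Seq (Inc 3) (Seq (Store 2 2 4) (Inc 2))))"
  let ?s = "set_reg 3 0 (set_reg 2 2 s)"
  have step: "wp W ?b (\<lambda>s'' t. \<exists>N'. I s'' N' \<and> t + 1 + N' \<le> N) s'"
    if I: "I s' N" and "holds (Less 2 5) s'" for s' N
  proof -
    have fr: "reg s' 5 = h" "arr s' 0 = arr s 0" using I assms(3) by (auto simp: I_def frame_def)
    have lt: "reg s' 2 < h" using that fr by simp
    obtain j where j: "reg s' 2 = j + 2"
      using I by (metis I_def le_add_diff_inverse2)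
    have "arr s 0 (Suc (2 * j)) = f (j + 2)"
    proof -
      have "Suc (2 * j) < 2 * (h - 2)" using lt j by linarith
      then show ?thesis by (simp add: assms(1) pairs_array_def)
    qed
    then show ?thesis
      using I lt fr assms(5) j by (auto simp: I_def fun_eq_iff)
  qed
  have "I ?s (6 * (h - 2))" using assms by (auto simp: I_def)
  then have "wp W (While (Less 2 5) ?b) (\<lambda>s' t. arr s' 2 = (\<lambda>x. if 2 \<le> x \<and> x < h then f x else 0) \<and>
      frame {2, 3, 4} {2} s s' \<and> t \<le> 6 * (h - 2) + 1) ?s"
  proof (rule wp_WhileI[of I], goal_cases)
    case (1 s' N)
    then show ?case by (rule step)
  next
    case a: (2 s' t N)
    then have "reg s' 5 = h" using assms(3) by (auto simp: I_def frame_def)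
    with a have "reg s' 2 = h" by (auto simp: I_def)
    with a show ?case by (auto simp: I_def)
  qed
  then show ?thesis
    using assms unfolding read_pairs_def by (auto elim!: wp_mono)
qed

lemma wp_write_pairs:
  assumes "reg s 5 = h" "2 \<le> h" "2 * h \<le> W"
  shows "wp W write_pairs (\<lambda>s' t. output_pairs s' = map (\<lambda>i. (i, arr s 2 i)) [2..<h] \<and>
    t \<le> 8 * h + 4) s"
proof -
  define I where "I s' N \<longleftrightarrow> 2 \<le> reg s' 2 \<and> reg s' 2 \<le> h \<and> reg s' 1 = reg s' 2 - 2 \<and>
      reg s' 3 = 2 * (reg s' 2 - 2) \<and>
      (\<forall>j < reg s' 2 - 2. arr s' 1 (2 * j) = j + 2 \<and> arr s' 1 (2 * j + 1) = arr s 2 (j + 2)) \<and>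
      frame {1, 2, 3, 4} {1} s s' \<and> N = 8 * (h - reg s' 2)" for s' N
  let ?b = "Seq (Store 1 3 2) (Seq (Inc 3) (Seq (Load 4 2 2) (Seq (Store 1 3 4)
       (Seq (Inc 3) (Seq (Inc 2) (Inc 1))))))"
  let ?s = "set_reg 3 0 (set_reg 2 2 (set_reg 1 0 s))"
  have step: "wp W ?b (\<lambda>s'' t. \<exists>N'. I s'' N' \<and> t + 1 + N' \<le> N) s'"
    if I: "I s' N" and "holds (Less 2 5) s'" for s' N
  proof -
    have fr: "reg s' 5 = h" "arr s' 2 = arr s 2" using I assms(1) by (auto simp: I_def frame_def)
    have lt: "reg s' 2 < h" using that fr by simp
    obtain j where j: "reg s' 2 = j + 2"
      using I by (metis I_def le_add_diff_inverse2)
    show ?thesis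
      using I lt fr assms(3) j
      by (auto simp: I_def less_Suc_eq double_not_eq_Suc_double Suc_double_not_eq_double)
  qed
  have "I ?s (8 * (h - 2))" using assms by (auto simp: I_def)
  then have "wp W (While (Less 2 5) ?b) (\<lambda>s' t. output_pairs s' = map (\<lambda>i. (i, arr s 2 i)) [2..<h] \<and>
    t \<le> 8 * (h - 2) + 1) ?s"
  proof (rule wp_WhileI[of I], goal_cases)
    case (1 s' N)
    then show ?case by (rule step)
  next
    case a: (2 s' t N)
    then have "reg s' 5 = h" using assms(1) by (auto simp: I_def frame_def)
    with a have h: "reg s' 2 = h" by (auto simp: I_def)
    with a have "output_pairs s' = map (\<lambda>i. (i, arr s 2 i)) [2..<h]"
      by (intro nth_equalityI) (auto simp: I_def output_pairs_def)
    with a show ?case by auto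
  qed
  then show ?thesis
    using assms unfolding write_pairs_def by (auto elim!: wp_mono)
qed

section \<open>The program for Theta\<close>

text \<open>
  The walk that starts in \<open>i\<close> colours new vertices with \<open>i\<close> until it meets a coloured vertex. It has
  closed a new cycle if and only if that vertex has colour \<open>i\<close>. The vertices 1 and \<open>n\<close> get colour 1,
  which is not the colour of any walk.
\<close>

definition colour_walk :: com where
  "colour_walk = While (Equal 3 7) (Seq (Store 3 4 2) (Seq (Load 4 2 4) (Load 3 3 4)))"

definition mark_cycle :: com where
  "mark_cycle = Seq (Copy 9 4) (Seq (Load 10 2 4)
     (Seq (While (NotEqual 10 4) (Seq (If (Less 9 10) (Copy 9 10) Skip) (Load 10 2 10)))
       (Store 4 9 8)))"

definition find_maxima :: com where
  "find_maxima = Seq (SetConst 8 1) (Seq (Store 3 8 8) (Seq (Store 3 0 8) (Seq (SetConst 2 2)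
     (While (Less 2 0) (Seq (Copy 4 2) (Seq (Load 3 3 4) (Seq colour_walk
       (Seq (If (Equal 3 2) mark_cycle Skip) (Inc 2)))))))))"

definition relink :: com where
  "relink = Seq (Copy 6 0) (Seq (Copy 2 0) (Seq (Dec 2) (Seq
     (While (Less 8 2) (Seq (Load 3 4 2)
       (Seq (If (Equal 3 7) Skip (Seq (Load 4 2 2) (Seq (Store 2 6 4) (Copy 6 2)))) (Dec 2))))
     (Store 2 6 8))))"

definition theta_prog :: com where
  "theta_prog = Seq (Copy 5 0) (Seq read_pairs (Seq find_maxima (Seq relink
     (Seq (Copy 5 0) (Seq (Inc 5) write_pairs)))))"

text \<open>The list \<open>ps\<close> holds the newly coloured vertices in the order of the walk.
  The cost is measured by its length, which lets the outer loop add up all walks. Termination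
  follows since \<open>ps\<close> stays inside the set \<open>U\<close> of vertices uncoloured at
  the start; the colours of 1 and \<open>n\<close> stop the walk before it leaves the domain of
  \<open>F\<close>.\<close>

lemma wp_colour_walk:
  assumes F: "F \<in> {2..n - 1} \<rightarrow> {1..n}" "arr s 2 = F"
    and s: "reg s 7 = 0" "2 \<le> reg s 2" "reg s 4 = v" "v \<in> {1..n}" "reg s 3 = arr s 3 v"
    and col: "arr s 3 1 \<noteq> 0" "arr s 3 n \<noteq> 0"
  shows "wp W colour_walk (\<lambda>s' t. \<exists>ps. distinct ps \<and> set ps \<subseteq> {2..n - 1} \<and>
    path_of F (ps @ [reg s' 4]) \<and> hd (ps @ [reg s' 4]) = v \<and> (\<forall>x \<in> set ps. arr s 3 x = 0) \<and>
    arr s' 3 = (\<lambda>x. if x \<in> set ps then reg s 2 else arr s 3 x) \<and>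
    arr s' 3 (reg s' 4) \<noteq> 0 \<and> reg s' 3 = arr s' 3 (reg s' 4) \<and>
    frame {3, 4} {3} s s' \<and> t \<le> 4 * length ps + 1) s"
proof -
  define U where "U = {x \<in> {2..n - 1}. arr s 3 x = 0}"
  define J where "J ps s' \<longleftrightarrow> distinct ps \<and> set ps \<subseteq> {2..n - 1} \<and> reg s' 4 \<in> {1..n} \<and>
    path_of F (ps @ [reg s' 4]) \<and> hd (ps @ [reg s' 4]) = v \<and> (\<forall>x \<in> set ps. arr s 3 x = 0) \<and>
    arr s' 3 = (\<lambda>x. if x \<in> set ps then reg s 2 else arr s 3 x) \<and>
    reg s' 3 = arr s' 3 (reg s' 4) \<and> frame {3, 4} {3} s s'" for ps s'
  have le: "length ps \<le> card U" if "distinct ps" "set ps \<subseteq> {2..n - 1}" "\<forall>x \<in> set ps. arr s 3 x = 0"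
    for ps
  proof -
    have "set ps \<subseteq> U" "finite U" using that by (auto simp: U_def)
    then have "card (set ps) \<le> card U" by (intro card_mono)
    then show ?thesis using distinct_card[OF that(1)] by simp
  qed
  define I where "I s' N \<longleftrightarrow> (\<exists>ps. J ps s' \<and> N = 4 * (card U - length ps))" for s' N
  have step: "wp W (Seq (Store 3 4 2) (Seq (Load 4 2 4) (Load 3 3 4)))
      (\<lambda>s'' t. \<exists>N'. I s'' N' \<and> t + 1 + N' \<le> N) s'"
    if I: "I s' N" and eq: "holds (Equal 3 7) s'" for s' N
  proof -
    obtain ps where J: "J ps s'" and N: "N = 4 * (card U - length ps)"
      using I by (auto simp: I_def)
    have fr: "reg s' 7 = 0" "reg s' 2 = reg s 2" "arr s' 2 = F"
      using J s(1) F(2) by (auto simp: J_def frame_def)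
    define u where "u = reg s' 4"
    have "reg s' 3 = arr s' 3 u" using J unfolding J_def u_def by blast
    then have zero: "arr s' 3 u = 0" using eq fr by simp
    have u0: "u \<notin> set ps" "arr s 3 u = 0" using zero J s(2) by (auto simp: J_def split: if_splits)
    then have "u \<noteq> 1" "u \<noteq> n" using col by auto
    then have u: "u \<in> {2..n - 1}" using J by (auto simp: J_def u_def)
    have ps': "distinct (ps @ [u])" "set (ps @ [u]) \<subseteq> {2..n - 1}" "\<forall>x \<in> set (ps @ [u]). arr s 3 x = 0"
      using J u u0 by (auto simp: J_def)
    have "length (ps @ [u]) \<le> card U" using le[OF ps'] .
    moreover have "F u \<in> {1..n}" using F(1) u by blast
    moreover have "path_of F ((ps @ [u]) @ [F u])" "hd ((ps @ [u]) @ [F u]) = v"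
      using J by (auto simp: J_def u_def successively_append_iff hd_append)
    \<comment> \<open>The colour of \<open>F u\<close> is read after \<open>u\<close> has been
      coloured, so a loop \<open>F u = u\<close> ends the walk.\<close>
    moreover define s'' where "s'' = set_reg 3 (((arr s' 3)(u := reg s 2)) (F u))
      (set_reg 4 (F u) (set_arr 3 u (reg s 2) s'))"
    ultimately have "J (ps @ [u]) s''" using J ps' by (auto simp: J_def)
    then have "I s'' (4 * (card U - length (ps @ [u])))" unfolding I_def by blast
    then show ?thesis using N fr \<open>length (ps @ [u]) \<le> card U\<close> by (auto simp: s''_def u_def)
  qed
  have "J [] s" using s by (simp add: J_def)
  then have "I s (4 * card U)" by (force simp: I_def)
  then show ?thesis
    unfolding colour_walk_def
  proof (rule wp_WhileI[of I], goal_cases)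
    case (1 s' N)
    then show ?case by (rule step)
  next
    case (2 s' t N)
    then obtain ps where J: "J ps s'" and nz: "\<not> holds (Equal 3 7) s'"
      and t: "t + 4 * (card U - length ps) \<le> 4 * card U + 1" by (auto simp: I_def)
    have "reg s' 7 = 0" using J s(1) by (auto simp: J_def frame_def)
    moreover have "length ps \<le> card U" using J by (intro le) (auto simp: J_def)
    ultimately show ?case using J nz t by (intro exI[of _ ps]) (auto simp: J_def)
  qed
qed

lemma frame_trans:
  "frame R A s s' \<Longrightarrow> frame R' A' s' s'' \<Longrightarrow> R' \<subseteq> R \<Longrightarrow> A' \<subseteq> A \<Longrightarrow> frame R A s s''"
  unfolding frame_def by (metis subsetD)

text \<open>The traversal begins one step after \<open>hd b\<close>, with \<open>hd b\<close> as
  provisional maximum, and ends on returning there. A cycle of length 1 needs no iteration.\<close>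

lemma wp_mark_cycle:
  assumes b: "fun_cycle D F b" "hd b = reg s 4" and s: "arr s 2 = F" "reg s 8 = 1"
  shows "wp W mark_cycle (\<lambda>s' t. arr s' 4 = (arr s 4)(Max (set b) := 1) \<and>
    frame {9, 10} {4} s s' \<and> t \<le> 4 * length b + 5) s"
proof -
  have path: "path_of F (b @ [hd b])" and "b \<noteq> []" "distinct b"
    using b(1) by (auto simp: fun_cycle_def successively_append_iff)
  define J where "J p q s' \<longleftrightarrow> b = p @ q \<and> p \<noteq> [] \<and> reg s' 10 = hd (q @ [hd b]) \<and>
    reg s' 9 = Max (set p) \<and> frame {9, 10} {} s s'" for p q s'
  define I where "I s' N \<longleftrightarrow> (\<exists>p q. J p q s' \<and> N = 4 * length q)" for s' N
  let ?b = "Seq (If (Less 9 10) (Copy 9 10) Skip) (Load 10 2 10)"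
  let ?s = "set_reg 10 (arr s 2 (reg s 4)) (set_reg 9 (reg s 4) s)"
  have step: "wp W ?b (\<lambda>s'' t. \<exists>N'. I s'' N' \<and> t + 1 + N' \<le> N) s'"
    if I: "I s' N" and ne: "holds (NotEqual 10 4) s'" for s' N
  proof -
    obtain p q where J: "J p q s'" and N: "N = 4 * length q"
      using I by (auto simp: I_def)
    have fr: "reg s' 4 = hd b" "arr s' 2 = F"
      using J s b(2) by (auto simp: J_def frame_def)
    then have "q \<noteq> []" using ne J by (auto simp: J_def)
    then obtain x r where q: "q = x # r" by (cases q) auto
    have "path_of F (p @ x # r @ [hd b])" using path J q by (simp add: J_def)
    then have "F x = hd (r @ [hd b])" by (auto simp: successively_append_iff successively_Cons)
    moreover define M where "M = Max (set p)"
    have "Max (set (p @ [x])) = max x M"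
      using J by (simp add: J_def M_def)
    then have mx: "Max (set (p @ [x])) = (if M < x then x else M)"
      by (simp del: set_append add: max_def)
    moreover have x: "reg s' 10 = x" using J q by (simp add: J_def)
    ultimately have "J (p @ [x]) r (set_reg 10 (F x) (if reg s' 9 < x then set_reg 9 x s' else s'))"
      using J q mx unfolding J_def M_def[symmetric] by (auto simp del: set_append)
    then have "I (set_reg 10 (F x) (if reg s' 9 < x then set_reg 9 x s' else s')) (4 * length r)"
      unfolding I_def by blast
    then show ?thesis using N fr q x by (auto split: if_splits)
  qed
  have "J [hd b] (tl b) ?s"
  proof -
    have "b = hd b # tl b" using \<open>b \<noteq> []\<close> by simp
    then have "path_of F (hd b # tl b @ [hd b])" using path by (metis append_Cons)
    then have "F (hd b) = hd (tl b @ [hd b])" by (auto simp: successively_Cons)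
    then show ?thesis using b(2) s \<open>b \<noteq> []\<close> by (cases b) (auto simp: J_def)
  qed
  then have "I ?s (4 * length (tl b))" unfolding I_def by blast
  then have "wp W (While (NotEqual 10 4) ?b) (\<lambda>s' t. reg s' 9 = Max (set b) \<and> frame {9, 10} {} s s' \<and>
      t \<le> 4 * length b + 1) ?s"
  proof (rule wp_WhileI[of I], goal_cases)
    case (1 s' N)
    then show ?case by (rule step)
  next
    case (2 s' t N)
    then obtain p q where J: "J p q s'" and eq: "\<not> holds (NotEqual 10 4) s'"
      and t: "t + 4 * length q \<le> 4 * length (tl b) + 1" by (auto simp: I_def)
    have "reg s' 4 = hd b" using J b(2) by (auto simp: J_def frame_def)
    then have "hd (q @ [hd b]) = hd p" using eq J by (auto simp: J_def)
    then have "q = []"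
      using J \<open>distinct b\<close> by (cases q; cases p) (auto simp: J_def)
    then show ?case using J t by (auto simp: J_def)
  qed
  then show ?thesis
    using assms unfolding mark_cycle_def
    by (auto simp: frame_def fun_eq_iff elim!: wp_mono)
qed

lemma walk_closing_cycle:
  assumes ps: "distinct ps" "set ps \<subseteq> D" "path_of F (ps @ [v])" and pq: "ps = p @ v # q"
  shows "fun_cycle D F (v # q)"
proof -
  have "path_of F (p @ (v # q) @ [v])" using ps(3) pq by simp
  then have "path_of F ((v # q) @ [v])" unfolding successively_append_iff by blast
  then have "path_of F (v # q)" "F (last (v # q)) = v"
    unfolding successively_append_iff by auto
  then show ?thesis using ps(1,2) pq by (auto simp: fun_cycle_def)
qed

text \<open>\<open>C\<close> is the set coloured before the walk \<open>ps\<close>. A cycle that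
  meets \<open>ps\<close> follows it to its end \<open>v\<close>. If \<open>v\<close> lies in the
  closed set \<open>C\<close>, so does the cycle; otherwise it is the one that the walk has just
  closed. So a walk adds at most one cycle.\<close>

lemma walk_new_cycles:
  assumes closed: "\<forall>x \<in> C. x \<in> D \<longrightarrow> F x \<in> C"
    and ps: "distinct ps" "set ps \<subseteq> D" "path_of F (ps @ [v])"
    and b: "fun_cycle D F b" "set b \<subseteq> C \<union> set ps"
  shows "v \<in> C \<Longrightarrow> set b \<subseteq> C"
    and "ps = p @ v # q \<Longrightarrow> set b \<subseteq> C \<or> set b = set (v # q)"
proof -
  have v: "set b \<subseteq> C \<or> v \<in> set b"
  proof (cases "set b \<inter> set ps = {}")
    case False
    then show ?thesis using path_of_reaches_end[OF ps(3) b(1)] by auto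
  qed (use b(2) in auto)
  show "set b \<subseteq> C" if "v \<in> C"
    using v fun_cycle_subset[OF b(1) _ that] closed b(1) by (auto simp: fun_cycle_def)
  show "set b \<subseteq> C \<or> set b = set (v # q)" if "ps = p @ v # q"
    using v fun_cycle_eq_if_meet[OF b(1) walk_closing_cycle[OF ps that]] by auto
qed

lemma wp_find_maxima:
  assumes F: "F \<in> {2..n - 1} \<rightarrow> {1..n}" "arr s 2 = F"
    and s: "reg s 0 = n" "reg s 7 = 0" "arr s 3 = (\<lambda>_. 0)" "arr s 4 = (\<lambda>_. 0)"
    and W: "2 \<le> n" "n \<le> W"
  shows "wp W find_maxima (\<lambda>s' t.
    arr s' 4 = (\<lambda>x. if \<exists>b. fun_cycle {2..n - 1} F b \<and> x = Max (set b) then 1 else 0) \<and>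
    reg s' 8 = 1 \<and> frame {2, 3, 4, 8, 9, 10} {3, 4} s s' \<and> t \<le> 19 * n + 5) s"
proof -
  let ?D = "{2..n - 1}"
  define mk where "mk C x = (if \<exists>b. fun_cycle ?D F b \<and> set b \<subseteq> C \<and> x = Max (set b) then 1 else 0 :: nat)"
    for C x
  define col where "col s' = {x. arr s' 3 x \<noteq> 0}" for s' :: state
  \<comment> \<open>All colours are below \<open>reg s' 2\<close>, so the colour of the next walk
    identifies its own vertices. \<open>mk\<close> marks the maxima of the cycles inside the
    coloured set. In \<open>N\<close>, 11 is the fixed cost of a start vertex, including the
    constant parts of walking and marking; 8 per uncoloured vertex pays 4 for colouring it and 4 for
    passing it again when its cycle is marked.\<close>
  define I where "I s' N \<longleftrightarrow> 2 \<le> reg s' 2 \<and> reg s' 2 \<le> n \<and> {1, n} \<subseteq> col s' \<and> {2..<reg s' 2} \<subseteq> col s' \<and>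
      (\<forall>x \<in> col s'. x \<in> ?D \<longrightarrow> F x \<in> col s') \<and> (\<forall>x. arr s' 3 x < reg s' 2) \<and>
      arr s' 4 = mk (col s') \<and> reg s' 8 = 1 \<and> frame {2, 3, 4, 8, 9, 10} {3, 4} s s' \<and>
      N = 11 * (n - reg s' 2) + 8 * card (?D - col s')" for s' N
  let ?b = "Seq (Copy 4 2) (Seq (Load 3 3 4) (Seq colour_walk
       (Seq (If (Equal 3 2) mark_cycle Skip) (Inc 2))))"
  let ?s = "set_reg 2 2 (set_arr 3 n 1 (set_arr 3 1 1 (set_reg 8 1 s)))"
  have step: "wp W ?b (\<lambda>s'' t. \<exists>N'. I s'' N' \<and> t + 1 + N' \<le> N) s'"
    if I: "I s' N" and lt: "holds (Less 2 0) s'" for s' N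
  proof -
    define i where "i = reg s' 2"
    have fr: "reg s' 0 = n" "reg s' 7 = 0" "arr s' 2 = F"
      using I s F(2) by (auto simp: I_def frame_def)
    have i: "2 \<le> i" "i < n" using lt fr(1) I by (auto simp: i_def I_def)
    let ?s1 = "set_reg 3 (arr s' 3 i) (set_reg 4 i s')"
    let ?Q = "\<lambda>s'' t. \<exists>N'. I s'' N' \<and> 1 + (1 + t) + 1 + N' \<le> N"
    have "wp W (Seq colour_walk (Seq (If (Equal 3 2) mark_cycle Skip) (Inc 2))) ?Q ?s1"
      unfolding wp_simps(8)[of W colour_walk]
    proof (rule wp_mono[OF wp_colour_walk[of F n _ i]], goal_cases)
      case (10 s2 t)
      have s1: "reg ?s1 2 = i" "arr ?s1 3 = arr s' 3" by (simp_all add: i_def)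
      obtain ps where ps: "distinct ps" "set ps \<subseteq> ?D" "path_of F (ps @ [reg s2 4])"
          "hd (ps @ [reg s2 4]) = i" "\<forall>x \<in> set ps. arr s' 3 x = 0"
        and s2: "arr s2 3 = (\<lambda>x. if x \<in> set ps then i else arr s' 3 x)"
          "arr s2 3 (reg s2 4) \<noteq> 0" "reg s2 3 = arr s2 3 (reg s2 4)" "frame {3, 4} {3} ?s1 s2"
        and t: "t \<le> 4 * length ps + 1"
        using 10[unfolded s1] by blast
      define v where "v = reg s2 4"
      define C where "C = col s'"
      have fr2: "reg s2 0 = n" "reg s2 7 = 0" "arr s2 2 = F" "reg s2 2 = i" "reg s2 8 = 1"
          "arr s2 4 = mk C" "frame {2, 3, 4, 8, 9, 10} {3, 4} s s2"
        using I fr s2(4) by (auto simp: frame_def i_def I_def C_def)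
      have C2: "col s2 = C \<union> set ps"
        using s2(1) ps(5) i by (auto simp: col_def C_def)
      have disj: "set ps \<inter> C = {}" using ps(5) by (auto simp: col_def C_def)
      have closed: "\<forall>x \<in> C. x \<in> ?D \<longrightarrow> F x \<in> C" using I by (auto simp: I_def C_def)
      have v: "v \<in> C \<union> set ps" using s2(2) C2 by (auto simp: col_def v_def)
      have path: "path_of F (ps @ [v])" using ps(3) by (simp add: v_def)
      note cycI = walk_closing_cycle[OF ps(1,2) path]
      note new = walk_new_cycles[OF closed ps(1,2) path]
      have closed2: "\<forall>x \<in> col s2. x \<in> ?D \<longrightarrow> F x \<in> col s2"
      proof (intro ballI impI)
        fix x assume x: "x \<in> col s2" "x \<in> ?D"
        show "F x \<in> col s2"
        proof (cases "x \<in> set ps")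
          case True
          then have "F x \<in> set (tl (ps @ [v]))" using path_of_image[OF path] by simp
          then have "F x \<in> set (ps @ [v])" by (meson list.set_sel(2) append_is_Nil_conv not_Cons_self2)
          then show ?thesis using v C2 by auto
        qed (use x C2 closed in auto)
      qed
      have "i \<in> set (ps @ [v])" using ps(4) hd_in_set[of "ps @ [v]"] by (simp add: v_def)
      then have iC: "i \<in> col s2" using v C2 by auto
      have card: "card (?D - col s2) + length ps = card (?D - C)"
      proof -
        have "?D - C = (?D - col s2) \<union> set ps" "(?D - col s2) \<inter> set ps = {}"
          using C2 ps(2) disj by auto
        then show ?thesis
          using card_Un_disjoint[of "?D - col s2" "set ps"] distinct_card[OF ps(1)] by simp
      qed
      have fin: "I (set_reg 2 (Suc i) s3) (11 * (n - Suc i) + 8 * card (?D - col s2))"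
        if "arr s3 3 = arr s2 3" "arr s3 4 = mk (col s2)" "reg s3 8 = 1"
          "frame {2, 3, 4, 8, 9, 10} {3, 4} s s3" for s3
      proof -
        have "col (set_reg 2 (Suc i) s3) = col s2" using that(1) by (simp add: col_def)
        moreover have "arr s2 3 x < Suc i" for x
          using s2(1) I by (auto simp: I_def i_def less_Suc_eq)
        moreover have "{2..<Suc i} \<subseteq> col s2" using iC I C2
          by (auto simp: I_def C_def i_def less_Suc_eq subset_iff)
        moreover have "{1, n} \<subseteq> col s2" using I C2 by (auto simp: I_def C_def)
        ultimately show ?thesis using that i closed2 by (simp add: I_def)
      qed
      have N: "N = 11 * (n - i) + 8 * card (?D - C)" using I by (simp add: I_def i_def C_def)
      show ?case
      proof (cases "v \<in> set ps")
        case False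
        then have "reg s2 3 = arr s' 3 v" using s2 by (simp add: v_def)
        then have ne: "reg s2 3 \<noteq> reg s2 2" using I fr2(4) by (simp add: I_def i_def nat_neq_iff)
        have "v \<in> C" using v False by simp
        then have "set b \<subseteq> col s2 \<longleftrightarrow> set b \<subseteq> C" if "fun_cycle ?D F b" for b
          using new(1)[OF that] C2 by auto
        then have "mk (col s2) = mk C"
          by (simp add: mk_def fun_eq_iff cong: conj_cong)
        then have "I (set_reg 2 (Suc i) s2) (11 * (n - Suc i) + 8 * card (?D - col s2))"
          using fin[of s2] fr2 by simp
        moreover have "t + 6 + (11 * (n - Suc i) + 8 * card (?D - col s2)) \<le> N"
          using t card N i by simp
        ultimately show ?thesis using fr2(4) ne i W by auto
      next
        case True
        obtain p q where pq: "ps = p @ v # q" using split_list[OF True] by blast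
        have cyc: "fun_cycle ?D F (v # q)"
          using cycI[OF pq] .
        have eq: "reg s2 3 = reg s2 2" using s2 True fr2(4) by (simp add: v_def)
        have if_or: "(if A then 1 else if B then 1 else 0) = (if R then 1 else 0 :: nat)"
          if "R \<longleftrightarrow> A \<or> B" for A B R using that by simp
        have mk: "(mk C)(Max (set (v # q)) := 1) = mk (col s2)"
        proof
          fix x
          have sub: "set b \<subseteq> col s2 \<longleftrightarrow> set b \<subseteq> C \<or> set b = set (v # q)" if "fun_cycle ?D F b" for b
            using new(2)[OF that _ pq] pq C2 by auto
          have "(\<exists>b. fun_cycle ?D F b \<and> set b \<subseteq> col s2 \<and> x = Max (set b)) \<longleftrightarrow>
              x = Max (set (v # q)) \<or> (\<exists>b. fun_cycle ?D F b \<and> set b \<subseteq> C \<and> x = Max (set b))"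
            (is "?L \<longleftrightarrow> ?R")
          proof
            assume ?L
            then obtain b where b: "fun_cycle ?D F b" "set b \<subseteq> col s2" "x = Max (set b)" by blast
            then show ?R using sub[OF b(1)] by metis
          next
            assume ?R
            then show ?L using sub cyc by blast
          qed
          then show "((mk C)(Max (set (v # q)) := 1)) x = mk (col s2) x"
            unfolding mk_def fun_upd_def by (rule if_or)
        qed
        have len: "length (v # q) \<le> length ps" unfolding pq by simp
        have "wp W mark_cycle (\<lambda>s3 t'. wp W (Inc 2) (\<lambda>s4 t''. ?Q s4 (t + (1 + t' + t''))) s3) s2"
        proof (rule wp_mono[OF wp_mark_cycle[OF cyc]], goal_cases)
          case (4 s3 t')
          then have upd: "arr s3 4 = (arr s2 4)(Max (set (v # q)) := 1)"
            and frm: "frame {9, 10} {4} s2 s3" and t': "t' \<le> 4 * length (v # q) + 5" by blast+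
          have s4: "arr s3 4 = mk (col s2)" unfolding upd fr2(6) by (rule mk)
          have s3: "arr s3 3 = arr s2 3" "reg s3 8 = 1" "reg s3 2 = i"
            using frameD[OF frm] fr2 by simp_all
          have s3': "frame {2, 3, 4, 8, 9, 10} {3, 4} s s3"
            by (rule frame_trans[OF fr2(7) frm]) auto
          have "t' \<le> 4 * length ps + 5" using t' len by linarith
          then have "t + (1 + t' + 1) + 3 + (11 * (n - Suc i) + 8 * card (?D - col s2)) \<le> N"
            using t card N i by simp
          moreover have "I (set_reg 2 (Suc i) s3) (11 * (n - Suc i) + 8 * card (?D - col s2))"
            using s3 s4 s3' by (intro fin)
          ultimately show ?case using s3(3) i W by auto
        qed (use fr2 v_def in auto)
        then show ?thesis using eq by simp
      qed
    qed (use F I i fr in \<open>auto simp: I_def col_def i_def\<close>)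
    then show ?thesis
      by (simp only: wp_simps(8)[of W "Copy 4 2"] wp_simps(8)[of W "Load 3 3 4"] wp_simps(3,6)
          set_simps fun_upd_same i_def)
  qed
  have "I ?s (11 * (n - 2) + 8 * card (?D - {1, n}))"
  proof -
    have c: "col ?s = {1, n}" using s by (auto simp: col_def)
    have "\<not> set b \<subseteq> {1, n}" if "fun_cycle ?D F b" for b
    proof -
      have "hd b \<in> set b" "hd b \<in> ?D" using that unfolding fun_cycle_def by (meson hd_in_set subsetD)+
      moreover have "hd b \<notin> {1, n}" using \<open>hd b \<in> ?D\<close> W by auto
      ultimately show ?thesis by blast
    qed
    then have mk0: "mk {1, n} = (\<lambda>_. 0)" unfolding mk_def by meson
    show ?thesis unfolding I_def c mk0 using s W by auto
  qed
  then have "wp W (While (Less 2 0) ?b) (\<lambda>s' t.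
      arr s' 4 = (\<lambda>x. if \<exists>b. fun_cycle ?D F b \<and> x = Max (set b) then 1 else 0) \<and>
      reg s' 8 = 1 \<and> frame {2, 3, 4, 8, 9, 10} {3, 4} s s' \<and> t \<le> 19 * n + 1) ?s"
  proof (rule wp_WhileI[of I], goal_cases)
    case (1 s' N)
    then show ?case by (rule step)
  next
    case (2 s' t N)
    then have I: "I s' N" and ge: "\<not> holds (Less 2 0) s'"
      and t: "t + N \<le> 11 * (n - 2) + 8 * card (?D - {1, n}) + 1" by auto
    have "reg s' 0 = n" using I s by (auto simp: I_def frame_def)
    then have "reg s' 2 = n" using I ge by (auto simp: I_def)
    then have "{2..<n} \<subseteq> col s'" using I by (simp add: I_def)
    moreover have "?D \<subseteq> {2..<n}" by auto
    ultimately have "set b \<subseteq> col s'" if "fun_cycle ?D F b" for b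
      using that by (auto simp: fun_cycle_def)
    then have "mk (col s') = (\<lambda>x. if \<exists>b. fun_cycle ?D F b \<and> x = Max (set b) then 1 else 0)"
      unfolding mk_def by meson
    moreover have "card (?D - {1, n}) \<le> n"
      using card_mono[of ?D "?D - {1, n}"] by simp
    ultimately show ?case using I t by (simp add: I_def)
  qed
  then show ?thesis
    using s W unfolding find_maxima_def by (auto elim!: wp_mono)
qed

text \<open>
  Since the maxima are processed in decreasing order, \<^const>\<open>relink\<close> can work in place: the value at
  \<open>m\<close> is read before it is overwritten.
\<close>

fun shift_values :: "(nat \<Rightarrow> nat) \<Rightarrow> nat \<Rightarrow> nat list \<Rightarrow> nat \<Rightarrow> nat" where
  "shift_values F p [] = F(p := 1)"
| "shift_values F p (m # ms) = shift_values (F(p := F m)) m ms"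

text \<open>The update at \<open>p\<close> precedes the remaining ones; distinctness ensures that
  the later reads still see the original values of \<open>F\<close>.\<close>

lemma shift_values_eqI:
  assumes "distinct (p # ms)" "\<And>i. i < length ms \<Longrightarrow> g ((p # ms) ! i) = F (ms ! i)"
    and "g (last (p # ms)) = 1" "x \<notin> set (p # ms) \<Longrightarrow> g x = F x"
  shows "shift_values F p ms x = g x"
  using assms
proof (induction ms arbitrary: F p)
  case (Cons m ms)
  have "shift_values (F(p := F m)) m ms x = g x"
  proof (rule Cons.IH)
    show "g ((m # ms) ! i) = (F(p := F m)) (ms ! i)" if "i < length ms" for i
      using Cons.prems(1) Cons.prems(2)[of "Suc i"] that nth_mem[of i ms] by auto
    show "g x = (F(p := F m)) x" if "x \<notin> set (m # ms)"
      using Cons.prems(2)[of 0] Cons.prems(4) that by auto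
  qed (use Cons.prems in auto)
  then show ?case by simp
qed auto

lemma wp_relink:
  assumes s: "reg s 0 = n" "reg s 7 = 0" "reg s 8 = 1" and W: "2 \<le> n"
  shows "wp W relink (\<lambda>s' t.
    arr s' 2 = shift_values (arr s 2) n (filter (\<lambda>x. arr s 4 x \<noteq> 0) (rev [2..<n])) \<and>
    frame {2, 3, 4, 6} {2} s s' \<and> t \<le> 7 * n + 5) s"
proof -
  define ms where "ms i = filter (\<lambda>x. arr s 4 x \<noteq> 0) (rev [2..<i])" for i
  \<comment> \<open>Relinking the maxima still ahead, starting from the pending tail in register 6,
    turns the present array into the final one. \<open>ms (Suc i)\<close> lists the marked vertices
    up to \<open>i\<close>.\<close>
  define I where "I s' N \<longleftrightarrow> 1 \<le> reg s' 2 \<and>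
      shift_values (arr s' 2) (reg s' 6) (ms (Suc (reg s' 2))) = shift_values (arr s 2) n (ms n) \<and>
      frame {2, 3, 4, 6} {2} s s' \<and> N = 7 * reg s' 2" for s' N
  let ?b = "Seq (Load 3 4 2)
       (Seq (If (Equal 3 7) Skip (Seq (Load 4 2 2) (Seq (Store 2 6 4) (Copy 6 2)))) (Dec 2))"
  let ?s = "set_reg 2 (n - 1) (set_reg 2 n (set_reg 6 n s))"
  have step: "wp W ?b (\<lambda>s'' t. \<exists>N'. I s'' N' \<and> t + 1 + N' \<le> N) s'"
    if I: "I s' N" and lt: "holds (Less 8 2) s'" for s' N
  proof -
    have fr: "reg s' 8 = 1" "reg s' 7 = 0" "arr s' 4 = arr s 4"
      using I s by (auto simp: I_def frame_def)
    obtain i where i: "reg s' 2 = Suc i" "1 \<le> i" using lt fr by (cases "reg s' 2") auto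
    have "ms (Suc (Suc i)) = (if arr s 4 (Suc i) \<noteq> 0 then Suc i # ms (Suc i) else ms (Suc i))"
      using i by (simp add: ms_def)
    then show ?thesis using I fr i by (auto simp: I_def)
  qed
  have "I ?s (7 * (n - 1))" using s W by (auto simp: I_def)
  then have "wp W (While (Less 8 2) ?b) (\<lambda>s' t. shift_values (arr s' 2) (reg s' 6) [] = shift_values (arr s 2) n (ms n) \<and>
      frame {2, 3, 4, 6} {2} s s' \<and> t \<le> 7 * n + 1) ?s"
  proof (rule wp_WhileI[of I], goal_cases)
    case (1 s' N)
    then show ?case by (rule step)
  next
    case (2 s' t N)
    then have I: "I s' N" and ge: "\<not> holds (Less 8 2) s'" and t: "t + N \<le> 7 * (n - 1) + 1"
      by auto
    have "reg s' 8 = 1" using I s by (auto simp: I_def frame_def)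
    then have "reg s' 2 = 1" using I ge by (auto simp: I_def)
    then have "ms (Suc (reg s' 2)) = []" by (simp add: ms_def)
    then show ?case using I t by (simp add: I_def)
  qed
  then show ?thesis
    using s unfolding relink_def ms_def
    by (auto simp: frame_def elim!: wp_mono)
qed

text \<open>The phases add up to at most \<open>40 * n + 28\<close>, which is below
  \<open>60 * n\<close> for \<open>n \<ge> 2\<close>. The bound \<open>10 * n\<close> leaves room
  for \<open>2 * (n + 1)\<close>, the bound required for writing the pairs.\<close>

lemma wp_theta_prog:
  assumes f: "f \<in> fun_space n" and n: "2 \<le> n" and W: "10 * n \<le> W"
  shows "wp W theta_prog (\<lambda>s' t. output_pairs s' = tree_pairs n (Theta n f) \<and> t \<le> 60 * n)
    (initial_state n (fun_pairs n f))"
proof -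
  let ?D = "{2..n - 1}" and ?s = "set_reg 5 n (initial_state n (fun_pairs n f))"
  define F where "F = (\<lambda>x. if 2 \<le> x \<and> x < n then f x else 0)"
  have Ff: "F x = f x" if "x \<in> ?D" for x using that by (auto simp: F_def)
  have F: "F \<in> ?D \<rightarrow> {1..n}" using f Ff by (auto simp: fun_space_def)
  have cyc: "fun_cycle ?D F b \<longleftrightarrow> fun_cycle ?D f b" for b
    using fun_cycle_cong[of ?D F b ?D f] fun_cycle_cong[of ?D f b ?D F] Ff
    by (auto simp: fun_cycle_def subset_iff)
  obtain g bs where rel: "theta_rel n f g bs" using theta_rel_exists[OF n] by meson
  define m where "m = map last bs"
  note succ = theta_rel_successors[OF rel m_def]
  have mset: "set m \<subseteq> ?D" "distinct m"
  proof -
    have "last b \<in> ?D" if "b \<in> set bs" for b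
      using that rel last_in_set[of b] by (fastforce simp: theta_rel_def fun_cycle_def)
    then show "set m \<subseteq> ?D" by (auto simp: m_def)
    have "m = cycle_maxima n f" using theta_rel_cycle_maxima[OF rel] by (simp add: m_def)
    then show "distinct m" by (simp add: cycle_maxima_def)
  qed
  \<comment> \<open>Both lists are strictly decreasing, so it suffices that their sets
    agree.\<close>
  have marks: "filter (\<lambda>x. \<exists>b. fun_cycle ?D F b \<and> x = Max (set b)) (rev [2..<n]) = m"
    (is "filter ?P _ = m")
  proof -
    have dec: "sorted_wrt (>) m" using rel by (simp add: m_def theta_rel_def block_list_def)
    have dec': "sorted_wrt (>) (filter ?P (rev [2..<n]))"
      by (intro sorted_wrt_filter) (simp add: sorted_wrt_rev)
    have "set (filter ?P (rev [2..<n])) = set m"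
    proof -
      have "set m = {x. ?P x}" using theta_rel_maxima[OF rel] cyc by (auto simp: m_def)
      moreover have "?D \<subseteq> {2..<n}" by auto
      ultimately show ?thesis using mset(1) by fastforce
    qed
    then show ?thesis
      using rev_sorted_list_of_set[OF dec] rev_sorted_list_of_set[OF dec'] by simp
  qed
  have tree: "shift_values F n m x = g x" if "x \<in> {2..n}" for x
  proof (rule shift_values_eqI)
    show "g ((n # m) ! i) = F (m ! i)" if "i < length m" for i
    proof -
      have "m ! i \<in> ?D" using that mset(1) nth_mem by blast
      then show ?thesis using succ(1)[OF that] Ff by simp
    qed
    have "n \<notin> ?D" using n by auto
    then show "distinct (n # m)" using mset by auto
    show "g x = F x" if "x \<notin> set (n # m)"
      using that succ(3)[of x] Ff[of x] \<open>x \<in> {2..n}\<close> by auto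
  qed (use succ(2) in simp)
  have out: "tree_pairs n (Theta n f) = map (\<lambda>i. (i, g i)) [2..<n + 1]"
    using Theta_eq_tree_of[OF rel n] by (simp only: tree_pairs_tree_of)
  have "wp W (Seq read_pairs (Seq find_maxima (Seq relink (Seq (Copy 5 0) (Seq (Inc 5) write_pairs)))))
    (\<lambda>s' t. output_pairs s' = tree_pairs n (Theta n f) \<and> 1 + t \<le> 60 * n) ?s"
    unfolding wp_simps(8)[of W read_pairs]
  proof (rule wp_mono[OF wp_read_pairs[where f = f and h = n]], goal_cases)
    case (6 s1 t1)
    then have s1: "arr s1 2 = F" "reg s1 0 = n" "reg s1 7 = 0" "arr s1 3 = (\<lambda>_. 0)" "arr s1 4 = (\<lambda>_. 0)"
      and t1: "t1 \<le> 6 * n + 3"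
      by (auto simp: F_def frame_def initial_state_def)
    show ?case unfolding wp_simps(8)[of W find_maxima]
    proof (rule wp_mono[OF wp_find_maxima[OF F s1]], goal_cases)
      case (3 s2 t2)
      then have s2: "arr s2 2 = F" "reg s2 0 = n" "reg s2 7 = 0" "reg s2 8 = 1"
          "filter (\<lambda>x. arr s2 4 x \<noteq> 0) (rev [2..<n]) = m" and t2: "t2 \<le> 19 * n + 5"
        using s1 marks by (auto simp: frame_def)
      show ?case unfolding wp_simps(8)[of W relink]
      proof (rule wp_mono[OF wp_relink[OF s2(2-4) n]], goal_cases)
        case (1 s3 t3)
        then have s3: "arr s3 2 = shift_values F n m" "reg s3 0 = n" and t3: "t3 \<le> 7 * n + 5"
          using s2 by (auto simp: frame_def)
        let ?s4 = "set_reg 5 (Suc n) (set_reg 5 n s3)"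
        have "wp W write_pairs (\<lambda>s' t. output_pairs s' = map (\<lambda>i. (i, arr s3 2 i)) [2..<n + 1] \<and>
            t \<le> 8 * (n + 1) + 4) ?s4"
          using wp_write_pairs[of ?s4 "n + 1" W] n W by simp
        then have "wp W write_pairs (\<lambda>s' t. output_pairs s' = tree_pairs n (Theta n f) \<and>
            t \<le> 8 * (n + 1) + 4) ?s4"
        proof (rule wp_mono, goal_cases)
          case (1 s' t)
          then show ?case unfolding out using s3(1) tree by auto
        qed
        then show ?case using s3(2) n W t1 t2 t3 by (auto elim!: wp_mono)
      qed
    qed (use n W in auto)
  qed (use n W in \<open>auto simp: initial_state_def fun_pairs_def\<close>)
  then show ?thesis
    unfolding theta_prog_def by (simp add: initial_state_def)
qed

section \<open>The program for the inverse of Theta\<close>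

text \<open>
  The path from \<open>n\<close> to the root is walked forwards to record predecessors and then backwards, with the
  latest right-to-left maximum in register 9. When the next maximum is met, register 4 holds the first
  vertex of the block that ends in the latest one. The first of these assignments goes to
  cell 1 of array 2, which is not part of the output.
\<close>

definition walk_path :: com where
  "walk_path = Seq (SetConst 8 1) (Seq (Copy 4 0)
     (While (NotEqual 4 8) (Seq (Load 10 2 4) (Seq (Store 3 10 4) (Copy 4 10)))))"

definition cut_path :: com where
  "cut_path = Seq (Copy 9 8) (While (NotEqual 4 0)
     (Seq (Load 10 3 4) (Seq (If (Less 9 10) (Seq (Store 2 9 4) (Copy 9 10)) Skip) (Copy 4 10))))"

definition inverse_prog :: com where
  "inverse_prog = Seq (Copy 5 0) (Seq (Inc 5) (Seq read_pairs (Seq walk_path (Seq cut_path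
     (Seq (Copy 5 0) write_pairs)))))"

text \<open>Array 3 receives the predecessor of every vertex after the first, including the root,
  where the way back starts. Distinctness keeps a later entry from overwriting an earlier
  one.\<close>

lemma wp_walk_path:
  assumes path: "path_of G (xs @ [1])" "distinct (xs @ [1])" "hd (xs @ [1]) = reg s 0"
    and s: "arr s 2 = G" and W: "1 \<le> W"
  shows "wp W walk_path (\<lambda>s' t. (\<forall>i < length xs. arr s' 3 ((xs @ [1]) ! Suc i) = xs ! i) \<and>
    reg s' 4 = 1 \<and> reg s' 8 = 1 \<and> frame {4, 8, 10} {3} s s' \<and> t \<le> 4 * length xs + 3) s"
proof -
  define J where "J ps qs s' \<longleftrightarrow> xs = ps @ qs \<and> reg s' 4 = hd (qs @ [1]) \<and>
    (\<forall>i < length ps. arr s' 3 ((xs @ [1]) ! Suc i) = xs ! i) \<and> reg s' 8 = 1 \<and>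
    frame {4, 8, 10} {3} s s'" for ps qs s'
  define I where "I s' N \<longleftrightarrow> (\<exists>ps qs. J ps qs s' \<and> N = 4 * length qs)" for s' N
  let ?b = "Seq (Load 10 2 4) (Seq (Store 3 10 4) (Copy 4 10))"
  let ?s = "set_reg 4 (reg s 0) (set_reg 8 1 s)"
  have step: "wp W ?b (\<lambda>s'' t. \<exists>N'. I s'' N' \<and> t + 1 + N' \<le> N) s'"
    if I: "I s' N" and ne: "holds (NotEqual 4 8) s'" for s' N
  proof -
    obtain ps qs where J: "J ps qs s'" and N: "N = 4 * length qs"
      using I unfolding I_def by blast
    have "qs \<noteq> []" using J ne by (auto simp: J_def)
    then obtain x r where qs: "qs = x # r" by (cases qs) auto
    have G: "arr s' 2 = G" using J s by (auto simp: J_def frame_def)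
    have xs: "xs @ [1] = ps @ x # (r @ [1])" using J qs by (simp add: J_def)
    have x: "reg s' 4 = x" using J qs by (simp add: J_def)
    have "path_of G (ps @ x # (r @ [1]))" using path(1) xs by simp
    then have Gx: "G x = hd (r @ [1])" by (auto simp: successively_append_iff successively_Cons)
    also have "\<dots> = (xs @ [1]) ! Suc (length ps)"
      using xs by (simp add: nth_append hd_conv_nth)
    finally have Gx': "G x = (xs @ [1]) ! Suc (length ps)" .
    define s'' where "s'' = set_reg 4 (G x) (set_arr 3 (G x) x (set_reg 10 (G x) s'))"
    have prev: "\<forall>i < length ps. arr s' 3 ((xs @ [1]) ! Suc i) = xs ! i"
      and fr: "reg s' 8 = 1" "frame {4, 8, 10} {3} s s'"
      using J unfolding J_def by blast+
    have dec: "xs = (ps @ [x]) @ r" using J qs by (simp add: J_def)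
    have upd: "arr s'' 3 ((xs @ [1]) ! Suc i) = xs ! i" if i: "i < length (ps @ [x])" for i
    proof (cases "i = length ps")
      case True
      moreover have "xs ! length ps = x" by (simp add: dec nth_append)
      ultimately show ?thesis by (simp add: s''_def Gx')
    next
      case False
      have "length ps < length xs" by (simp add: dec)
      then have "(xs @ [1]) ! Suc i \<noteq> (xs @ [1]) ! Suc (length ps)"
        using nth_eq_iff_index_eq[OF path(2)] False i by simp
      then have "arr s'' 3 ((xs @ [1]) ! Suc i) = arr s' 3 ((xs @ [1]) ! Suc i)"
        by (simp add: s''_def Gx')
      then show ?thesis using prev False i by simp
    qed
    have "reg s'' 4 = hd (r @ [1])" "reg s'' 8 = 1" "frame {4, 8, 10} {3} s s''"
      using fr Gx by (simp_all add: s''_def)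
    then have "J (ps @ [x]) r s''"
      unfolding J_def using dec upd by blast
    then have "I s'' (4 * length r)" unfolding I_def by blast
    then show ?thesis using N qs G x by (auto simp: s''_def)
  qed
  have "J [] xs ?s" using path(3) by (simp add: J_def)
  then have "I ?s (4 * length xs)" unfolding I_def by blast
  then have "wp W (While (NotEqual 4 8) ?b) (\<lambda>s' t.
    (\<forall>i < length xs. arr s' 3 ((xs @ [1]) ! Suc i) = xs ! i) \<and>
    reg s' 4 = 1 \<and> reg s' 8 = 1 \<and> frame {4, 8, 10} {3} s s' \<and> t \<le> 4 * length xs + 1) ?s"
  proof (rule wp_WhileI[of I], goal_cases)
    case (1 s' N)
    then show ?case by (rule step)
  next
    case (2 s' t N)
    then obtain ps qs where J: "J ps qs s'" unfolding I_def by blast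
    have "hd (qs @ [1]) = 1" using 2(2) J by (simp add: J_def)
    then have "qs = []" using path(2) J by (cases qs) (auto simp: J_def)
    moreover have "ps = xs" using J \<open>qs = []\<close> by (simp add: J_def)
    ultimately have "J xs [] s'" using J by simp
    then show ?case using 2(3) by (simp add: J_def)
  qed
  then show ?thesis
    using W unfolding walk_path_def by (auto elim!: wp_mono)
qed

lemma wp_cut_path:
  assumes xs: "xs = n # w" "distinct (xs @ [1])" "0 \<notin> set xs"
    and s: "reg s 0 = n" "reg s 4 = 1" "reg s 8 = 1" "arr s 2 = G"
      "\<And>i. i < length xs \<Longrightarrow> arr s 3 ((xs @ [1]) ! Suc i) = xs ! i"
  shows "wp W cut_path (\<lambda>s' t. (\<forall>b \<in> set (tl (blocks xs)). arr s' 2 (last b) = hd b) \<and>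
    (\<forall>x. x \<noteq> 1 \<longrightarrow> x \<notin> last ` set (tl (blocks xs)) \<longrightarrow> arr s' 2 x = G x) \<and>
    frame {4, 9, 10} {2} s s' \<and> t \<le> 6 * length xs + 2) s"
proof -
  \<comment> \<open>\<open>zs\<close> is the suffix already passed. Its first block may still grow
    to the left, so only the blocks in \<open>tl (blocks zs)\<close> have been closed. Register 9
    holds the last letter of the open block, which is the maximum of \<open>zs\<close>.\<close>
  define J where "J ps zs s' \<longleftrightarrow> xs = ps @ zs \<and> reg s' 4 = hd (zs @ [1]) \<and>
    reg s' 9 = (if zs = [] then 1 else last (hd (blocks zs))) \<and>
    (\<forall>b \<in> set (tl (blocks zs)). arr s' 2 (last b) = hd b) \<and>
    (\<forall>x. x \<noteq> 1 \<longrightarrow> x \<notin> last ` set (tl (blocks zs)) \<longrightarrow> arr s' 2 x = G x) \<and>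
    frame {4, 9, 10} {2} s s'" for ps zs s'
  define I where "I s' N \<longleftrightarrow> (\<exists>ps zs. J ps zs s' \<and> N = 6 * length ps)" for s' N
  let ?b = "Seq (Load 10 3 4) (Seq (If (Less 9 10) (Seq (Store 2 9 4) (Copy 9 10)) Skip) (Copy 4 10))"
  let ?s = "set_reg 9 1 s"
  have step: "wp W ?b (\<lambda>s'' t. \<exists>N'. I s'' N' \<and> t + 1 + N' \<le> N) s'"
    if I: "I s' N" and ne: "holds (NotEqual 4 0) s'" for s' N
  proof -
    obtain ps zs where J: "J ps zs s'" and N: "N = 6 * length ps"
      using I unfolding I_def by blast
    have fr: "reg s' 0 = n" "arr s' 3 = arr s 3" using J s by (auto simp: J_def frame_def)
    have "ps \<noteq> []" using J ne fr xs(1) by (auto simp: J_def)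
    then obtain p u where ps: "ps = p @ [u]" by (cases ps rule: rev_cases) auto
    define v where "v = hd (zs @ [1])"
    have v: "reg s' 4 = v" using J by (simp add: J_def v_def)
    have split: "xs @ [1] = p @ u # (zs @ [1])" using J ps by (simp add: J_def)
    have "v = (xs @ [1]) ! Suc (length p)"
      unfolding split by (simp add: nth_append hd_conv_nth v_def)
    moreover have "xs ! length p = u" "length p < length xs" using J ps by (auto simp: J_def nth_append)
    ultimately have u: "arr s' 3 v = u" using s(5)[of "length p"] fr by simp
    have "u \<in> set xs" "u \<noteq> 1" using J ps xs(2) by (auto simp: J_def)
    \<comment> \<open>Register 9 starts as 1, so the vertex just before the root passes the
      comparison and opens a block.\<close>
    then have u2: "1 < u" using xs(3) by (metis less_one linorder_neqE_nat)
    define s'' where "s'' = set_reg 4 u (if reg s' 9 < u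
      then set_reg 9 u (set_arr 2 (reg s' 9) v (set_reg 10 u s')) else set_reg 10 u s')"
    have "J p (u # zs) s''"
    proof (cases "blocks zs")
      case Nil
      then have "zs = []" using concat_blocks[of zs] by (metis concat.simps(1))
      then show ?thesis using J ps u2 by (auto simp: J_def s''_def)
    next
      case (Cons b bs)
      have zs: "zs = b @ concat bs" using concat_blocks[of zs] Cons by simp
      have bl: "b \<noteq> []" "\<And>c. c \<in> set bs \<Longrightarrow> last c < last b"
        using block_list_blocks[of zs] by (auto simp: Cons block_list_def)
      have r9: "reg s' 9 = last b" and v': "v = hd b" and zs': "zs \<noteq> []"
        using J Cons zs bl(1) by (auto simp: J_def v_def)
      show ?thesis
      proof (cases "last b < u")
        case True
        then have "blocks (u # zs) = [u] # b # bs" using Cons by simp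
        moreover have "last c \<noteq> last b" if "c \<in> set bs" for c using bl(2)[OF that] by simp
        ultimately show ?thesis
          using J ps True r9 v' Cons zs' by (auto simp: J_def s''_def)
      next
        case False
        then have "blocks (u # zs) = (u # b) # bs" using Cons by simp
        then show ?thesis
          using J ps False r9 v' Cons zs' bl(1) by (auto simp: J_def s''_def)
      qed
    qed
    then have "I s'' (6 * length p)" unfolding I_def by blast
    then show ?thesis using N ps u v by (auto simp: s''_def split: if_splits)
  qed
  have "J xs [] ?s" using s by (simp add: J_def)
  then have "I ?s (6 * length xs)" unfolding I_def by blast
  then have "wp W (While (NotEqual 4 0) ?b) (\<lambda>s' t.
    (\<forall>b \<in> set (tl (blocks xs)). arr s' 2 (last b) = hd b) \<and>
    (\<forall>x. x \<noteq> 1 \<longrightarrow> x \<notin> last ` set (tl (blocks xs)) \<longrightarrow> arr s' 2 x = G x) \<and>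
    frame {4, 9, 10} {2} s s' \<and> t \<le> 6 * length xs + 1) ?s"
  proof (rule wp_WhileI[of I], goal_cases)
    case (1 s' N)
    then show ?case by (rule step)
  next
    case (2 s' t N)
    then obtain ps zs where J: "J ps zs s'" unfolding I_def by blast
    have "reg s' 0 = n" using J s by (auto simp: J_def frame_def)
    then have "hd (zs @ [1]) = n" using 2(2) J by (simp add: J_def)
    then have "n \<in> set (zs @ [1])" by (metis hd_in_set snoc_eq_iff_butlast)
    then have "ps = []" using J xs by (cases ps) (auto simp: J_def)
    then have "zs = xs" using J by (simp add: J_def)
    then show ?case using J 2 by (simp add: J_def)
  qed
  then show ?thesis
    using s unfolding cut_path_def by (auto elim!: wp_mono)
qed

text \<open>Stated for an \<open>f\<close> already related to the tree, so that only the cutting of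
  the path has to be verified. The phases add up to at most \<open>24 * n + 21\<close>.\<close>

lemma wp_inverse_prog:
  assumes rel: "theta_rel n f g bs" and n: "2 \<le> n" and W: "10 * n \<le> W"
  shows "wp W inverse_prog (\<lambda>s' t. output_pairs s' = fun_pairs n f \<and> t \<le> 60 * n)
    (initial_state n (tree_pairs n (tree_of n g)))"
proof -
  let ?D = "{2..n - 1}"
  let ?s = "set_reg 5 (Suc n) (set_reg 5 n (initial_state n (tree_pairs n (tree_of n g))))"
  define G where "G = (\<lambda>x. if 2 \<le> x \<and> x < n + 1 then g x else 0)"
  define xs where "xs = n # concat bs"
  have bl: "block_list bs" and sub: "set (concat bs) \<subseteq> ?D" and "distinct (concat bs)"
    and "path_of g (xs @ [1])" and cyc: "\<And>b. b \<in> set bs \<Longrightarrow> fun_cycle ?D f b"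
    and other: "\<And>x. x \<in> ?D \<Longrightarrow> x \<notin> last ` set bs \<Longrightarrow> g x = f x"
    using rel by (auto simp: theta_rel_def xs_def)
  have xsD: "set xs \<subseteq> {2..n}" using sub n by (fastforce simp: xs_def)
  have path: "path_of G (xs @ [1])"
    using \<open>path_of g (xs @ [1])\<close> by (rule path_of_cong) (use xsD in \<open>auto simp: G_def\<close>)
  have "n \<notin> ?D" "1 \<notin> {2..n}" using n by auto
  then have dist: "distinct (xs @ [1])"
    using sub \<open>distinct (concat bs)\<close> xsD by (auto simp: xs_def)
  have len: "length xs \<le> n"
  proof -
    have "card (set xs) \<le> card {2..n}" using xsD by (intro card_mono) auto
    then show ?thesis using distinct_card[of xs] dist by simp
  qed
  \<comment> \<open>\<open>n\<close> exceeds every other letter and so is a block by itself.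
    Dropping it leaves exactly the cycles.\<close>
  have blk: "tl (blocks xs) = bs"
  proof -
    have "blocks xs = add_block n bs" by (simp add: xs_def blocks_concat[OF bl])
    moreover have "last b < n" if "b \<in> set bs" for b
    proof -
      have "last b \<in> ?D"
        using cyc[OF that] unfolding fun_cycle_def by (meson last_in_set subsetD)
      then show ?thesis using n by auto
    qed
    ultimately show ?thesis by (cases bs) auto
  qed
  have "wp W (Seq read_pairs (Seq walk_path (Seq cut_path (Seq (Copy 5 0) write_pairs))))
    (\<lambda>s' t. output_pairs s' = fun_pairs n f \<and> 2 + t \<le> 60 * n) ?s"
    unfolding wp_simps(8)[of W read_pairs]
  proof (rule wp_mono[OF wp_read_pairs[where f = g and h = "n + 1"]], goal_cases)
    case (6 s1 t1)
    then have s1: "arr s1 2 = G" "reg s1 0 = n" and t1: "t1 \<le> 6 * (n + 1) + 3"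
      by (auto simp: G_def frame_def initial_state_def)
    have hd: "hd (xs @ [1]) = reg s1 0" using s1 by (simp add: xs_def)
    show ?case unfolding wp_simps(8)[of W walk_path]
    proof (rule wp_mono[OF wp_walk_path[OF path dist hd s1(1)]], goal_cases)
      case (2 s2 t2)
      then have s2: "reg s2 0 = n" "reg s2 4 = 1" "reg s2 8 = 1" "arr s2 2 = G"
          "\<And>i. i < length xs \<Longrightarrow> arr s2 3 ((xs @ [1]) ! Suc i) = xs ! i"
        and t2: "t2 \<le> 4 * n + 3"
        using s1 len by (auto simp: frame_def)
      have "0 \<notin> set xs" using xsD by auto
      show ?case unfolding wp_simps(8)[of W cut_path]
      proof (rule wp_mono[OF wp_cut_path[OF xs_def dist \<open>0 \<notin> set xs\<close> s2(1-4)]], goal_cases)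
        case (1 i)
        then show ?case by (rule s2(5))
      next
        case (2 s3 t3)
        then have s3: "\<And>b. b \<in> set bs \<Longrightarrow> arr s3 2 (last b) = hd b"
            "\<And>x. x \<noteq> 1 \<Longrightarrow> x \<notin> last ` set bs \<Longrightarrow> arr s3 2 x = G x" "reg s3 0 = n"
          and t3: "t3 \<le> 6 * n + 2"
          using s2 len unfolding blk by (auto simp: frame_def)
        have out: "arr s3 2 x = f x" if x: "x \<in> {2..<n}" for x
        proof (cases "x \<in> last ` set bs")
          case True
          then show ?thesis using s3(1) cyc by (auto simp: fun_cycle_def)
        next
          case False
          then show ?thesis using s3(2)[of x] other[of x] x by (auto simp: G_def)
        qed
        have "wp W write_pairs (\<lambda>s' t. output_pairs s' = map (\<lambda>i. (i, arr s3 2 i)) [2..<n] \<and>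
            t \<le> 8 * n + 4) (set_reg 5 n s3)"
          using wp_write_pairs[of "set_reg 5 n s3" n W] n W by simp
        moreover have "map (\<lambda>i. (i, arr s3 2 i)) [2..<n] = fun_pairs n f"
          using out by (simp add: fun_pairs_def)
        ultimately show ?case using s3(3) n W t1 t2 t3 by (auto elim!: wp_mono)
      qed
    qed (use n W in auto)
  qed (use n W in \<open>auto simp: initial_state_def tree_pairs_tree_of\<close>)
  then show ?thesis
    using n W unfolding inverse_prog_def by (simp add: initial_state_def)
qed

lemma linear_time_computableI:
  assumes "\<And>n x. 2 \<le> n \<Longrightarrow> x \<in> X n \<Longrightarrow>
    wp (D * n) P (\<lambda>s t. output_pairs s = out n x \<and> t \<le> C * n) (initial_state n (inp n x))"
  shows "linear_time_computable X inp out"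
  unfolding linear_time_computable_def
proof (rule exI[of _ P], rule exI[of _ C], rule exI[of _ D], rule exI[of _ 1], intro allI impI ballI)
  fix n x assume "2 \<le> n" "x \<in> X n"
  then show "\<exists>t s. exec (D * n ^ 1) P (initial_state n (inp n x)) t s \<and> t \<le> C * n \<and>
      output_pairs s = out n x"
    using assms[of n x] unfolding wp_def by auto
qed

theorem theorem3:
  shows "(\<forall>n \<ge> 2. bij_betw (Theta n) (fun_space n) (rooted_trees n)) \<and>
    linear_time_computable fun_space fun_pairs (\<lambda>n f. tree_pairs n (Theta n f)) \<and>
    linear_time_computable rooted_trees tree_pairs
      (\<lambda>n T. fun_pairs n (inv_into (fun_space n) (Theta n) T))"
proof (intro conjI allI impI)
  fix n :: nat assume "2 \<le> n"
  then show "bij_betw (Theta n) (fun_space n) (rooted_trees n)" by (rule Theta_bij_betw)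
next
  show "linear_time_computable fun_space fun_pairs (\<lambda>n f. tree_pairs n (Theta n f))"
    by (rule linear_time_computableI[where D = 10 and C = 60 and P = theta_prog])
      (simp add: wp_theta_prog)
next
  show "linear_time_computable rooted_trees tree_pairs
      (\<lambda>n T. fun_pairs n (inv_into (fun_space n) (Theta n) T))"
  proof (rule linear_time_computableI[where D = 10 and C = 60 and P = inverse_prog])
    fix n T assume n: "2 \<le> n" and "T \<in> rooted_trees n"
    then obtain g where g: "rooted_fun n g" "T = tree_of n g"
      using rooted_trees_imp_tree_of by blast
    then obtain f bs where f: "f \<in> fun_space n" and rel: "theta_rel n f g bs"
      using theta_rel_surj n by blast
    \<comment> \<open>The preimage comes from \<open>theta_rel_surj\<close>; injectivity identifies
      it with the value chosen by \<open>inv_into\<close>.\<close>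
    have "inj_on (Theta n) (fun_space n)"
      using Theta_bij_betw[OF n] by (rule bij_betw_imp_inj_on)
    then have "inv_into (fun_space n) (Theta n) T = f"
      using inv_into_f_f[of "Theta n" "fun_space n" f] f Theta_eq_tree_of[OF rel n] g(2) by simp
    then show "wp (10 * n) inverse_prog
        (\<lambda>s t. output_pairs s = fun_pairs n (inv_into (fun_space n) (Theta n) T) \<and> t \<le> 60 * n)
        (initial_state n (tree_pairs n T))"
      using wp_inverse_prog[OF rel n] g(2) by simp
  qed
qed

end
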